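(* Let $R$ be essentially of finite type over an $F$-finite field of characteristic $p>0$, let $(M,\kappa)$ be a Cartier module over $R$ and let $f\in R$ be an $M$-regular element. Let $\lambda\ge0$ be rational. If $(M,\kappa)$ is $F$-regular, then $\tau(M,f^\lambda)=\kappa^e f^{\lceil\lambda p^e\rceil}M$ for all $e\gg0$.
   Context: All rings are commutative Noetherian of prime characteristic $p$; $F$ is the Frobenius, and $F^e_*M$ is $M$ with $R$ acting through $p^e$-th powers. $R$ is $F$-finite if $F_*R$ is a finitely generated $R$-module. A Cartier module $(M,\kappa)$ is a finitely generated $R$-module $M$ with an $R$-linear map $\kappa\colon F_*M\to M$; $\kappa^e\colon F^e_*M\to M$ is its iterate, and for $g\in R$, $\kappa^e g$ denotes $m\mapsto\kappa^e(gm)$; thus $\kappa^egM=\kappa^e(gM)$. An element $f\in R$ is $M$-regular if it is a non-zero-divisor on $M$. A Cartier algebra is an $\mathbb N$-graded ring $\mathcal C=\bigoplus_{e\ge0}\mathcal C_e$ with $\mathcal C_0=R$ and $r\varphi=\varphi r^{p^e}$ for $\varphi\in\mathcal C_e$, $r\in R$; $\mathcal C_+=\bigoplus_{e\ge1}\mathcal C_e$. A $\mathcal C$-module is a left $\mathcal C$-module finitely generated over $R$; it is nilpotent if $\mathcal C_+^aM=0$ for some $a$; a morphism is a nil-isomorphism if its kernel and cokernel are nilpotent. Test modules: for $f\in R$ and rational $\lambda\ge0$ let $\mathcal C$ be the Cartier algebra with $\mathcal C_0=R$, $\mathcal C_e=\kappa^ef^{\lceil\lambda p^e\rceil}R$ ($e\ge1$),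 acting on $M$. $\tau(M,f^\lambda)$ is the smallest $\mathcal C$-submodule $N\subseteq M$ such that $H^0_\eta(N)_\eta\subseteq H^0_\eta(M)_\eta$ is a nil-isomorphism for every associated prime $\eta$ of the $R$-module $M$ ($H^0_\eta$ = elements killed by a power of $\eta$; the outer subscript is localization). If $R$ is essentially of finite type over an $F$-finite field, $\tau(M,f^\lambda)$ exists for all $\lambda$ and is a non-increasing, right-continuous, discrete filtration. $(M,\kappa)$ is $F$-regular if $\tau(M,f^0)=M$ (this does not depend on $f$). *)

theory Defs
  imports "HOL-Algebra.Module" "HOL-Algebra.Generated_Rings" "HOL-Algebra.Ideal_Product"
    "HOL-Algebra.Ring_Divisibility" "HOL-Computational_Algebra.Primes" "HOL.Rat"
begin

section \<open>Rings\<close>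

definition has_char :: "('a, 'c) ring_scheme \<Rightarrow> nat \<Rightarrow> bool" where
  "has_char R p \<longleftrightarrow> (\<forall>n::nat. [n] \<cdot>\<^bsub>R\<^esub> \<one>\<^bsub>R\<^esub> = \<zero>\<^bsub>R\<^esub> \<longleftrightarrow> p dvd n)"

definition fin_gen_algebra :: "'k ring \<Rightarrow> 'b ring \<Rightarrow> ('k \<Rightarrow> 'b) \<Rightarrow> bool" where
  "fin_gen_algebra k A \<iota> \<longleftrightarrow> cring k \<and> cring A \<and> \<iota> \<in> ring_hom k A \<and>
     (\<exists>X. finite X \<and> X \<subseteq> carrier A \<and> generate_ring A (\<iota> ` carrier k \<union> X) = carrier A)"

text \<open>\<open>\<psi>\<close> exhibits \<open>R\<close> as the ring of fractions of \<open>A\<close> with denominators in \<open>S\<close>.  A ring is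
  essentially of finite type over \<open>k\<close> if it is such a localization of some finitely generated
  \<open>k\<close>-algebra \<open>A\<close>; since HOL cannot quantify over the type of \<open>A\<close> inside a formula, statements about
  rings essentially of finite type are made for arbitrary witnesses \<open>A\<close>, \<open>S\<close>, \<open>\<psi>\<close>.\<close>

definition is_localization :: "'b ring \<Rightarrow> 'b set \<Rightarrow> 'a ring \<Rightarrow> ('b \<Rightarrow> 'a) \<Rightarrow> bool" where
  "is_localization A S R \<psi> \<longleftrightarrow> cring A \<and> cring R \<and> submonoid S A \<and> \<psi> \<in> ring_hom A R \<and>
     (\<forall>s\<in>S. \<psi> s \<in> Units R) \<and>
     (\<forall>r\<in>carrier R. \<exists>a\<in>carrier A. \<exists>s\<in>S. r = \<psi> a \<otimes>\<^bsub>R\<^esub> inv\<^bsub>R\<^esub> (\<psi> s)) \<and>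
     (\<forall>a\<in>carrier A. \<psi> a = \<zero>\<^bsub>R\<^esub> \<longrightarrow> (\<exists>s\<in>S. s \<otimes>\<^bsub>A\<^esub> a = \<zero>\<^bsub>A\<^esub>))"


section \<open>Modules\<close>

text \<open>The records for modules extend those for rings; the fields \<open>mult\<close> and \<open>one\<close> of a module
  carry no meaning and are left unspecified in the constructions below.\<close>

definition fin_gen_module :: "'a ring \<Rightarrow> ('a, 'm) module \<Rightarrow> bool" where
  "fin_gen_module R M \<longleftrightarrow> module R M \<and>
     (\<exists>X. finite X \<and> X \<subseteq> carrier M \<and> ((\<lambda>H. submodule H R M) hull X) = carrier M)"

definition linear_map :: "'a ring \<Rightarrow> ('a, 'm) module \<Rightarrow> ('a, 'n) module \<Rightarrow> ('m \<Rightarrow> 'n) \<Rightarrow> bool" where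
  "linear_map R M N h \<longleftrightarrow> h \<in> carrier M \<rightarrow> carrier N \<and>
     (\<forall>x\<in>carrier M. \<forall>y\<in>carrier M. h (x \<oplus>\<^bsub>M\<^esub> y) = h x \<oplus>\<^bsub>N\<^esub> h y) \<and>
     (\<forall>r\<in>carrier R. \<forall>x\<in>carrier M. h (r \<odot>\<^bsub>M\<^esub> x) = r \<odot>\<^bsub>N\<^esub> h x)"

definition ring_as_module :: "'a ring \<Rightarrow> ('a, 'a) module" where
  "ring_as_module R = \<lparr>carrier = carrier R, monoid.mult = monoid.mult R, one = one R, zero = zero R,
     add = add R, smult = monoid.mult R\<rparr>"

definition regular_on :: "'a ring \<Rightarrow> ('a, 'm) module \<Rightarrow> 'a \<Rightarrow> bool" where
  "regular_on R M f \<longleftrightarrow> f \<in> carrier R \<and> (\<forall>x\<in>carrier M. f \<odot>\<^bsub>M\<^esub> x = \<zero>\<^bsub>M\<^esub> \<longrightarrow> x = \<zero>\<^bsub>M\<^esub>)"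

definition assoc_primes :: "'a ring \<Rightarrow> ('a, 'm) module \<Rightarrow> 'a set set" where
  "assoc_primes R M =
     {\<eta>. primeideal \<eta> R \<and> (\<exists>x\<in>carrier M. \<eta> = {r \<in> carrier R. r \<odot>\<^bsub>M\<^esub> x = \<zero>\<^bsub>M\<^esub>})}"

text \<open>\<open>H\<^sup>0\<^sub>\<eta>(M)\<close>, as a submodule of \<open>M\<close>.\<close>

definition H0 :: "'a ring \<Rightarrow> ('a, 'm) module \<Rightarrow> 'a set \<Rightarrow> ('a, 'm) module" where
  "H0 R M \<eta> = M\<lparr>carrier := {x \<in> carrier M.
     \<exists>n::nat. \<forall>r \<in> \<eta> [^]\<^bsub>ideals_set R\<^esub> n. r \<odot>\<^bsub>M\<^esub> x = \<zero>\<^bsub>M\<^esub>}\<rparr>"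

definition quot_module :: "('a, 'm) module \<Rightarrow> 'm set \<Rightarrow> ('a, 'm set) module" where
  "quot_module M H = \<lparr>carrier = a_rcosets\<^bsub>M\<^esub> H, monoid.mult = undefined, one = undefined, zero = H,
     add = set_add M, smult = (\<lambda>r X. \<Union>x\<in>X. H +>\<^bsub>M\<^esub> (r \<odot>\<^bsub>M\<^esub> x))\<rparr>"

text \<open>The localization \<open>M\<^sub>\<eta>\<close> at a prime \<open>\<eta>\<close>; \<open>fraction R M \<eta> x s\<close> is the fraction \<open>x/s\<close>, an
  equivalence class of pairs.  The \<open>R\<close>-module structure of \<open>M\<^sub>\<eta>\<close> is all that is needed.\<close>

definition fraction :: "'a ring \<Rightarrow> ('a, 'm) module \<Rightarrow> 'a set \<Rightarrow> 'm \<Rightarrow> 'a \<Rightarrow> ('m \<times> 'a) set" where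
  "fraction R M \<eta> x s = {(y, t). y \<in> carrier M \<and> t \<in> carrier R - \<eta> \<and>
     (\<exists>u \<in> carrier R - \<eta>. u \<odot>\<^bsub>M\<^esub> (t \<odot>\<^bsub>M\<^esub> x) = u \<odot>\<^bsub>M\<^esub> (s \<odot>\<^bsub>M\<^esub> y))}"

definition localize :: "'a ring \<Rightarrow> ('a, 'm) module \<Rightarrow> 'a set \<Rightarrow> ('a, ('m \<times> 'a) set) module" where
  "localize R M \<eta> = \<lparr>carrier = {fraction R M \<eta> x s | x s. x \<in> carrier M \<and> s \<in> carrier R - \<eta>},
     monoid.mult = undefined, one = undefined,
     zero = fraction R M \<eta> \<zero>\<^bsub>M\<^esub> \<one>\<^bsub>R\<^esub>,
     add = (\<lambda>X Y. \<Union>(x, s)\<in>X. \<Union>(y, t)\<in>Y.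
              fraction R M \<eta> (t \<odot>\<^bsub>M\<^esub> x \<oplus>\<^bsub>M\<^esub> s \<odot>\<^bsub>M\<^esub> y) (s \<otimes>\<^bsub>R\<^esub> t)),
     smult = (\<lambda>r X. \<Union>(x, s)\<in>X. fraction R M \<eta> (r \<odot>\<^bsub>M\<^esub> x) s)\<rparr>"

definition localize_map ::
    "'a ring \<Rightarrow> ('a, 'n) module \<Rightarrow> 'a set \<Rightarrow> ('m \<Rightarrow> 'n) \<Rightarrow> ('m \<times> 'a) set \<Rightarrow> ('n \<times> 'a) set" where
  "localize_map R N \<eta> h X = (\<Union>(x, s)\<in>X. fraction R N \<eta> (h x) s)"


section \<open>Frobenius and Cartier modules\<close>

definition frob_push :: "nat \<Rightarrow> nat \<Rightarrow> 'a ring \<Rightarrow> ('a, 'm) module \<Rightarrow> ('a, 'm) module" where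
  "frob_push p e R M = M\<lparr>smult := \<lambda>r x. (r [^]\<^bsub>R\<^esub> (p ^ e)) \<odot>\<^bsub>M\<^esub> x\<rparr>"

definition F_finite :: "nat \<Rightarrow> 'a ring \<Rightarrow> bool" where
  "F_finite p R \<longleftrightarrow> fin_gen_module R (frob_push p 1 R (ring_as_module R))"

definition cartier_module :: "nat \<Rightarrow> 'a ring \<Rightarrow> ('a, 'm) module \<Rightarrow> ('m \<Rightarrow> 'm) \<Rightarrow> bool" where
  "cartier_module p R M \<kappa> \<longleftrightarrow> fin_gen_module R M \<and> linear_map R (frob_push p 1 R M) M \<kappa>"


section \<open>Modules over a Cartier algebra\<close>

text \<open>Only Cartier algebras \<open>C\<close> with \<open>C\<^sub>0 = R\<close> and \<open>C\<^sub>e = g\<^sub>e R\<close> cyclic as a right \<open>R\<close>-module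
  occur.  Such a \<open>C\<close> acts on an \<open>R\<close>-module through its homogeneous elements, so a \<open>C\<close>-module is
  encoded by a module together with an action \<open>act\<close>, where \<open>act e r\<close> is the action of
  \<open>g\<^sub>e r \<in> C\<^sub>e\<close> for \<open>r \<in> carrier R\<close> (with \<open>g\<^sub>0 = 1\<close>).\<close>

type_synonym ('a, 'm) graded_action = "nat \<Rightarrow> 'a \<Rightarrow> 'm \<Rightarrow> 'm"

definition C_submodule ::
    "'a ring \<Rightarrow> ('a, 'm) module \<Rightarrow> ('a, 'm) graded_action \<Rightarrow> 'm set \<Rightarrow> bool" where
  "C_submodule R M act N \<longleftrightarrow> submodule N R M \<and> (\<forall>e. \<forall>r\<in>carrier R. \<forall>x\<in>N. act e r x \<in> N)"

text \<open>\<open>C\<^sub>+ N\<close>, the additive subgroup generated by all \<open>\<phi> x\<close> with \<open>\<phi> \<in> C\<^sub>+\<close> and \<open>x \<in> N\<close>.\<close>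

definition C_plus ::
    "'a ring \<Rightarrow> ('a, 'm) module \<Rightarrow> ('a, 'm) graded_action \<Rightarrow> 'm set \<Rightarrow> 'm set" where
  "C_plus R M act N =
     generate (add_monoid M) {act e r x | e r x. e \<ge> 1 \<and> r \<in> carrier R \<and> x \<in> N}"

definition nilpotent :: "'a ring \<Rightarrow> ('a, 'm) module \<Rightarrow> ('a, 'm) graded_action \<Rightarrow> bool" where
  "nilpotent R M act \<longleftrightarrow> (\<exists>a::nat. (C_plus R M act ^^ a) (carrier M) = {\<zero>\<^bsub>M\<^esub>})"

definition C_linear :: "'a ring \<Rightarrow> ('a, 'm) module \<Rightarrow> ('a, 'm) graded_action \<Rightarrow>
    ('a, 'n) module \<Rightarrow> ('a, 'n) graded_action \<Rightarrow> ('m \<Rightarrow> 'n) \<Rightarrow> bool" where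
  "C_linear R M act N act' h \<longleftrightarrow> linear_map R M N h \<and>
     (\<forall>e. \<forall>r\<in>carrier R. \<forall>x\<in>carrier M. h (act e r x) = act' e r (h x))"

definition quot_act :: "('a, 'm) module \<Rightarrow> 'm set \<Rightarrow> ('a, 'm) graded_action \<Rightarrow>
    ('a, 'm set) graded_action" where
  "quot_act M H act e r X = (\<Union>x\<in>X. H +>\<^bsub>M\<^esub> act e r x)"

definition nil_isomorphism :: "'a ring \<Rightarrow> ('a, 'm) module \<Rightarrow> ('a, 'm) graded_action \<Rightarrow>
    ('a, 'n) module \<Rightarrow> ('a, 'n) graded_action \<Rightarrow> ('m \<Rightarrow> 'n) \<Rightarrow> bool" where
  "nil_isomorphism R M act N act' h \<longleftrightarrow> C_linear R M act N act' h \<and>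
     nilpotent R (M\<lparr>carrier := a_kernel M N h\<rparr>) act \<and>
     nilpotent R (quot_module N (h ` carrier M)) (quot_act N (h ` carrier M) act')"

text \<open>Elements of \<open>C\<^sub>e\<close> are \<open>p\<^sup>-\<^sup>e\<close>-linear, hence act on a localization by
  \<open>\<phi> (x/s) = \<phi> (s\<^bsup>p^e-1\<^esup> x / s\<^bsup>p^e\<^esup>) = \<phi> (s\<^bsup>p^e-1\<^esup> x) / s\<close>.\<close>

definition localize_act :: "nat \<Rightarrow> 'a ring \<Rightarrow> ('a, 'm) module \<Rightarrow> 'a set \<Rightarrow> ('a, 'm) graded_action \<Rightarrow>
    ('a, ('m \<times> 'a) set) graded_action" where
  "localize_act p R M \<eta> act e r X =
     (\<Union>(x, s)\<in>X. fraction R M \<eta> (act e r ((s [^]\<^bsub>R\<^esub> (p ^ e - 1)) \<odot>\<^bsub>M\<^esub> x)) s)"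


section \<open>Test modules\<close>

definition generic_nil_iso :: "nat \<Rightarrow> 'a ring \<Rightarrow> ('a, 'm) module \<Rightarrow> ('a, 'm) graded_action \<Rightarrow>
    'a set \<Rightarrow> 'm set \<Rightarrow> bool" where
  "generic_nil_iso p R M act \<eta> N =
     (let HN = H0 R (M\<lparr>carrier := N\<rparr>) \<eta>; HM = H0 R M \<eta> in
      nil_isomorphism R (localize R HN \<eta>) (localize_act p R HN \<eta> act)
        (localize R HM \<eta>) (localize_act p R HM \<eta> act) (localize_map R HM \<eta> (\<lambda>x. x)))"

text \<open>The Cartier algebra with \<open>C\<^sub>0 = R\<close> and \<open>C\<^sub>e = \<kappa>\<^sup>e f\<^bsup>ceil(t p^e)\<^esup> R\<close> for \<open>e \<ge> 1\<close>.\<close>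

definition test_act :: "nat \<Rightarrow> 'a ring \<Rightarrow> ('a, 'm) module \<Rightarrow> ('m \<Rightarrow> 'm) \<Rightarrow> 'a \<Rightarrow> rat \<Rightarrow>
    ('a, 'm) graded_action" where
  "test_act p R M \<kappa> f t e r x =
     (if e = 0 then r \<odot>\<^bsub>M\<^esub> x
      else (\<kappa> ^^ e) ((f [^]\<^bsub>R\<^esub> nat \<lceil>t * of_nat p ^ e\<rceil>) \<odot>\<^bsub>M\<^esub> (r \<odot>\<^bsub>M\<^esub> x)))"

definition test_candidate :: "nat \<Rightarrow> 'a ring \<Rightarrow> ('a, 'm) module \<Rightarrow> ('m \<Rightarrow> 'm) \<Rightarrow> 'a \<Rightarrow> rat \<Rightarrow>
    'm set \<Rightarrow> bool" where
  "test_candidate p R M \<kappa> f t N \<longleftrightarrow> C_submodule R M (test_act p R M \<kappa> f t) N \<and>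
     (\<forall>\<eta>\<in>assoc_primes R M. generic_nil_iso p R M (test_act p R M \<kappa> f t) \<eta> N)"

text \<open>\<open>is_test_module p R M \<kappa> f t N\<close> says that \<open>\<tau>(M, f\<^sup>t)\<close> exists and equals \<open>N\<close>.  Test modules
  are handled relationally, so that no junk value is attached to a test module which does not exist.\<close>

definition is_test_module :: "nat \<Rightarrow> 'a ring \<Rightarrow> ('a, 'm) module \<Rightarrow> ('m \<Rightarrow> 'm) \<Rightarrow> 'a \<Rightarrow> rat \<Rightarrow>
    'm set \<Rightarrow> bool" where
  "is_test_module p R M \<kappa> f t N \<longleftrightarrow> test_candidate p R M \<kappa> f t N \<and>
     (\<forall>N'. test_candidate p R M \<kappa> f t N' \<longrightarrow> N \<subseteq> N')"

lemma is_test_module_unique: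
  assumes "is_test_module p R M \<kappa> f t N" "is_test_module p R M \<kappa> f t N'"
  shows "N = N'"
  using assms unfolding is_test_module_def by blast

definition F_regular :: "nat \<Rightarrow> 'a ring \<Rightarrow> ('a, 'm) module \<Rightarrow> ('m \<Rightarrow> 'm) \<Rightarrow> bool" where
  "F_regular p R M \<kappa> \<longleftrightarrow> is_test_module p R M \<kappa> \<one>\<^bsub>R\<^esub> 0 (carrier M)"

text \<open>The choice of \<open>f = 1\<close> above is immaterial.\<close>

lemma F_regular_iff: "F_regular p R M \<kappa> \<longleftrightarrow> is_test_module p R M \<kappa> f 0 (carrier M)"
proof -
  have "test_act p R M \<kappa> \<one>\<^bsub>R\<^esub> 0 = test_act p R M \<kappa> f 0"
    by (intro ext) (simp add: test_act_def nat_pow_def)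
  then show ?thesis
    by (simp add: F_regular_def is_test_module_def test_candidate_def)
qed

end

theory Submission
  imports Defs
begin

text \<open>
  Write \<open>N\<^sub>e\<close> for \<open>\<kappa>\<^sup>e f\<^bsup>m(e)\<^esup> M\<close> with \<open>m(e) = \<lceil>t p\<^sup>e\<rceil>\<close>.  Since \<open>m(d + e) \<le> p\<^sup>e m(d)\<close> and
  \<open>a \<kappa>\<^sup>e x = \<kappa>\<^sup>e a\<^bsup>p^e\<^esup> x\<close>, powers of \<open>f\<close> can be moved to the right through powers of \<open>\<kappa>\<close> with
  something to spare; the whole argument lives on this.

  The submodule \<open>\<kappa> M\<close> is a candidate for \<open>\<tau>(M, f\<^sup>0)\<close>, because \<open>\<kappa>\<close> kills \<open>M / \<kappa> M\<close>; so
  \<open>F\<close>-regularity gives \<open>\<kappa> M = M\<close>.  Then \<open>N\<^sub>e = \<kappa>\<^sup>e f\<^bsup>m(e)\<^esup> \<kappa> M = \<kappa>\<^bsup>e+1\<^esup> f\<^bsup>p m(e)\<^esup> M\<close> lies in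
  \<open>N\<^bsub>e+1\<^esub>\<close>, and this ascending chain becomes stationary because \<open>M\<close> is noetherian
  (\<open>submodule_chain_stabilizes\<close>).  The stable value \<open>N\<close> contains every \<open>N\<^sub>e\<close>, hence \<open>C\<^sub>+ M\<close>.
  This makes it a \<open>C\<close>-submodule with \<open>C\<^sub>+\<close> killing \<open>M / N\<close>, thus a candidate for
  \<open>\<tau>(M, f\<^sup>t)\<close> (\<open>test_candidate_if_absorbs\<close>).

  It remains to see that any candidate \<open>N'\<close> for \<open>\<tau>(M, f\<^sup>t)\<close> contains every \<open>N\<^sub>e\<close> with \<open>e \<ge> 1\<close>
  (\<open>test_candidate_contains_power_image\<close>).  Let \<open>P\<close> be the set of all \<open>x\<close> with \<open>C\<^sub>+ x \<subseteq> N'\<close>.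
  The inequality for the exponents shows that \<open>P\<close> is stable under \<open>\<kappa>\<close> itself, and \<open>P\<close> contains
  \<open>N'\<close>.  As \<open>f\<close> is \<open>M\<close>-regular it is a unit at every associated prime \<open>\<eta>\<close> of \<open>M\<close>, where
  therefore \<open>C\<close> and the algebra generated by \<open>\<kappa>\<close> have the same operators; so \<open>P\<close> is a candidate
  for \<open>\<tau>(M, f\<^sup>0)\<close> (\<open>generic_nil_iso_transfer\<close>).  By \<open>F\<close>-regularity \<open>P = M\<close>, which says
  \<open>C\<^sub>+ M \<subseteq> N'\<close>.

  To argue in this way one must replace nil-isomorphisms of localizations by a statement about elements
  of \<open>M\<close>.  The inclusion of localizations is injective, so only its cokernel matters, and a
  product of \<open>a\<close> operators kills the cokernel if and only if it sends each element of \<open>H\<^sup>0\<^sub>\<eta>(M)\<close>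
  to an element with a multiple \<open>u x \<in> N\<close>, \<open>u \<notin> \<eta>\<close>
  (\<open>nil_isomorphism_iff_colon\<close>, \<open>generic_nil_iso_iff\<close>).
\<close>

section \<open>Ascending chains in finitely generated modules over noetherian rings\<close>

context module
begin

lemma submodule_zero_mem: "submodule H R M \<Longrightarrow> \<zero>\<^bsub>M\<^esub> \<in> H"
  using subgroup.one_closed[OF submodule.axioms(1)] by fastforce

lemma submodule_Int_family:
  assumes "\<And>H. H \<in> \<H> \<Longrightarrow> submodule H R M" and "\<H> \<noteq> {}"
  shows "submodule (\<Inter>\<H>) R M"
proof (rule submoduleI)
  show "\<Inter>\<H> \<subseteq> carrier M" using assms submoduleE(1) by (meson Inter_lower all_not_in_conv subset_trans)
  show "\<zero>\<^bsub>M\<^esub> \<in> \<Inter>\<H>" by (rule InterI, rule submodule_zero_mem, rule assms(1))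
  fix a assume a: "a \<in> \<Inter>\<H>"
  show "\<ominus>\<^bsub>M\<^esub> a \<in> \<Inter>\<H>"
    by (rule InterI, rule submoduleE(3), rule assms(1)) (use a in auto)
  show "r \<odot>\<^bsub>M\<^esub> a \<in> \<Inter>\<H>" if "r \<in> carrier R" for r
    by (rule InterI, rule submoduleE(4), rule assms(1)) (use a that in auto)
  show "a \<oplus>\<^bsub>M\<^esub> b \<in> \<Inter>\<H>" if "b \<in> \<Inter>\<H>" for b
    by (rule InterI, rule submoduleE(5), rule assms(1)) (use a that in auto)
qed

lemma submodule_hull:
  assumes "X \<subseteq> carrier M"
  shows "submodule ((\<lambda>H. submodule H R M) hull X) R M"
  unfolding hull_def by (rule submodule_Int_family) (use assms carrier_is_submodule in auto)

lemma submodule_add_cyclic: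
  assumes H: "submodule H R M" and x: "x \<in> carrier M"
  shows "submodule {y \<oplus>\<^bsub>M\<^esub> r \<odot>\<^bsub>M\<^esub> x | y r. y \<in> H \<and> r \<in> carrier R} R M" (is "submodule ?T R M")
proof (rule submoduleI)
  note HE = submoduleE[OF H]
  have Hc: "y \<in> carrier M" if "y \<in> H" for y using HE(1) that by blast
  show "?T \<subseteq> carrier M" using x Hc by auto
  have "\<zero>\<^bsub>M\<^esub> = \<zero>\<^bsub>M\<^esub> \<oplus>\<^bsub>M\<^esub> \<zero> \<odot>\<^bsub>M\<^esub> x" using x by simp
  then show "\<zero>\<^bsub>M\<^esub> \<in> ?T" using submodule_zero_mem[OF H] R.zero_closed by blast
  fix a assume "a \<in> ?T"
  then obtain y r where a: "a = y \<oplus>\<^bsub>M\<^esub> r \<odot>\<^bsub>M\<^esub> x" "y \<in> H" "r \<in> carrier R" by blast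
  have "\<ominus>\<^bsub>M\<^esub> a = \<ominus>\<^bsub>M\<^esub> y \<oplus>\<^bsub>M\<^esub> (\<ominus> r) \<odot>\<^bsub>M\<^esub> x"
    using a x Hc by (simp add: smult_l_minus M.minus_add)
  then show "\<ominus>\<^bsub>M\<^esub> a \<in> ?T" using HE(3)[OF a(2)] a(3) R.a_inv_closed by blast
  show "c \<odot>\<^bsub>M\<^esub> a \<in> ?T" if c: "c \<in> carrier R" for c
  proof -
    have "c \<odot>\<^bsub>M\<^esub> a = c \<odot>\<^bsub>M\<^esub> y \<oplus>\<^bsub>M\<^esub> (c \<otimes> r) \<odot>\<^bsub>M\<^esub> x"
      using a x Hc c by (simp add: smult_r_distr smult_assoc1)
    then show ?thesis using HE(4)[OF c a(2)] a(3) c R.m_closed by blast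
  qed
  fix b assume "b \<in> ?T"
  then obtain z s where b: "b = z \<oplus>\<^bsub>M\<^esub> s \<odot>\<^bsub>M\<^esub> x" "z \<in> H" "s \<in> carrier R" by blast
  have "a \<oplus>\<^bsub>M\<^esub> b = (y \<oplus>\<^bsub>M\<^esub> z) \<oplus>\<^bsub>M\<^esub> (r \<oplus> s) \<odot>\<^bsub>M\<^esub> x"
    using a b x Hc by (simp add: smult_l_distr M.a_ac)
  then show "a \<oplus>\<^bsub>M\<^esub> b \<in> ?T" using HE(5)[OF a(2) b(2)] a(3) b(3) R.a_closed by blast
qed

text \<open>The ideal of all coefficients which \<open>x\<close> can have, modulo \<open>H\<close>, in elements of \<open>N\<close>; it controls
  the part of \<open>N\<close> that is not seen by \<open>N \<inter> H\<close>.\<close>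

lemma ideal_of_coefficients:
  assumes H: "submodule H R M" and N: "submodule N R M" and x: "x \<in> carrier M"
  shows "ideal {r \<in> carrier R. \<exists>y\<in>H. y \<oplus>\<^bsub>M\<^esub> r \<odot>\<^bsub>M\<^esub> x \<in> N} R" (is "ideal ?I R")
proof -
  note HE = submoduleE[OF H] and NE = submoduleE[OF N]
  have Hc: "y \<in> carrier M" if "y \<in> H" for y using HE(1) that by blast
  have mult: "c \<otimes> r \<in> ?I" if r: "r \<in> ?I" and c: "c \<in> carrier R" for r c
  proof -
    obtain y where y: "y \<in> H" "y \<oplus>\<^bsub>M\<^esub> r \<odot>\<^bsub>M\<^esub> x \<in> N" "r \<in> carrier R" using r by blast
    have "c \<odot>\<^bsub>M\<^esub> y \<oplus>\<^bsub>M\<^esub> (c \<otimes> r) \<odot>\<^bsub>M\<^esub> x = c \<odot>\<^bsub>M\<^esub> (y \<oplus>\<^bsub>M\<^esub> r \<odot>\<^bsub>M\<^esub> x)"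
      using y x c Hc by (simp add: smult_r_distr smult_assoc1)
    then have "c \<odot>\<^bsub>M\<^esub> y \<oplus>\<^bsub>M\<^esub> (c \<otimes> r) \<odot>\<^bsub>M\<^esub> x \<in> N" using NE(4)[OF c y(2)] by simp
    then show ?thesis using HE(4)[OF c y(1)] c y(3) by blast
  qed
  have "subgroup ?I (add_monoid R)"
  proof (rule R.add.subgroupI)
    show "?I \<subseteq> carrier R" by blast
    have "\<zero>\<^bsub>M\<^esub> \<oplus>\<^bsub>M\<^esub> \<zero> \<odot>\<^bsub>M\<^esub> x \<in> N" using x submodule_zero_mem[OF N] by simp
    then show "?I \<noteq> {}" using submodule_zero_mem[OF H] R.zero_closed by blast
    fix r assume r: "r \<in> ?I"
    have "\<ominus> r = (\<ominus> \<one>) \<otimes> r" using r by (simp add: R.l_minus)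
    then show "\<ominus> r \<in> ?I" using mult[OF r, of "\<ominus> \<one>"] by simp
    fix s assume s: "s \<in> ?I"
    obtain y where y: "y \<in> H" "y \<oplus>\<^bsub>M\<^esub> r \<odot>\<^bsub>M\<^esub> x \<in> N" "r \<in> carrier R" using r by blast
    obtain z where z: "z \<in> H" "z \<oplus>\<^bsub>M\<^esub> s \<odot>\<^bsub>M\<^esub> x \<in> N" "s \<in> carrier R" using s by blast
    have "(y \<oplus>\<^bsub>M\<^esub> z) \<oplus>\<^bsub>M\<^esub> (r \<oplus> s) \<odot>\<^bsub>M\<^esub> x = (y \<oplus>\<^bsub>M\<^esub> r \<odot>\<^bsub>M\<^esub> x) \<oplus>\<^bsub>M\<^esub> (z \<oplus>\<^bsub>M\<^esub> s \<odot>\<^bsub>M\<^esub> x)"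
      using y z x Hc by (simp add: smult_l_distr M.a_ac)
    then have "(y \<oplus>\<^bsub>M\<^esub> z) \<oplus>\<^bsub>M\<^esub> (r \<oplus> s) \<odot>\<^bsub>M\<^esub> x \<in> N" using NE(5)[OF y(2) z(2)] by simp
    then show "r \<oplus> s \<in> ?I" using HE(5)[OF y(1) z(1)] y(3) z(3) by blast
  qed
  then show ?thesis
    using mult by (intro idealI R.ring_axioms) (auto simp: R.m_comm)
qed

text \<open>Induction on the generators.  Let \<open>K\<close> be the span of \<open>X\<close>.  If \<open>N \<subseteq> N'\<close> are submodules of
  \<open>K + R x\<close> with \<open>N \<inter> K = N' \<inter> K\<close> and with the same ideal of coefficients of \<open>x\<close>, then
  \<open>N = N'\<close>: correct an element of \<open>N'\<close> by one of \<open>N\<close> with the same coefficient, and the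
  difference lies in \<open>N' \<inter> K\<close>.  The intersections stabilize by induction, the ideals because \<open>R\<close> is
  noetherian.\<close>

lemma chain_in_hull_stabilizes:
  assumes "noetherian_ring R" and "finite X" and "X \<subseteq> carrier M"
    and "\<And>i. submodule (N i) R M" and "\<And>i. N i \<subseteq> (\<lambda>H. submodule H R M) hull X"
    and "\<And>i j. i \<le> j \<Longrightarrow> N i \<subseteq> N (j::nat)"
  shows "\<exists>n. \<forall>m\<ge>n. N m = N n"
  using assms(2-)
proof (induction X arbitrary: N)
  case empty
  have "submodule {\<zero>\<^bsub>M\<^esub>} R M" by (rule submoduleI) auto
  then have "N i \<subseteq> {\<zero>\<^bsub>M\<^esub>}" for i
    using empty.prems(3)[of i] hull_minimal[of "{}" "{\<zero>\<^bsub>M\<^esub>}" "\<lambda>H. submodule H R M"] by blast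
  then have "N i = {\<zero>\<^bsub>M\<^esub>}" for i using submodule_zero_mem[OF empty.prems(2)[of i]] by blast
  then show ?case by blast
next
  case (insert x X)
  interpret noetherian_ring R by (rule assms(1))
  let ?K = "(\<lambda>H. submodule H R M) hull X"
  have x: "x \<in> carrier M" and X: "X \<subseteq> carrier M" using insert.prems(1) by auto
  have K: "submodule ?K R M" by (rule submodule_hull[OF X])
  note KE = submoduleE[OF K] and NE = submoduleE[OF insert.prems(2)]
  let ?T = "{y \<oplus>\<^bsub>M\<^esub> r \<odot>\<^bsub>M\<^esub> x | y r. y \<in> ?K \<and> r \<in> carrier R}"
  have Kc: "y \<in> carrier M" if "y \<in> ?K" for y using KE(1) that by blast
  have "insert x X \<subseteq> ?T"
  proof -
    have "x = \<zero>\<^bsub>M\<^esub> \<oplus>\<^bsub>M\<^esub> \<one> \<odot>\<^bsub>M\<^esub> x" using x by simp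
    moreover have "y = y \<oplus>\<^bsub>M\<^esub> \<zero> \<odot>\<^bsub>M\<^esub> x" if "y \<in> X" for y using x X that by auto
    moreover have "X \<subseteq> ?K" by (rule hull_subset)
    ultimately show ?thesis
      using submodule_zero_mem[OF K] R.one_closed R.zero_closed by blast
  qed
  then have T: "N i \<subseteq> ?T" for i
    using insert.prems(3)[of i] submodule_add_cyclic[OF K x]
      hull_minimal[of "insert x X" ?T "\<lambda>H. submodule H R M"] by blast
  have "submodule (N i \<inter> ?K) R M" for i
    using submodule_Int_family[of "{N i, ?K}"] insert.prems(2) K by auto
  then obtain n1 where n1: "\<forall>m\<ge>n1. N m \<inter> ?K = N n1 \<inter> ?K"
    using insert.IH[OF X, of "\<lambda>i. N i \<inter> ?K"] insert.prems(4) by blast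
  define I where "I i = {r \<in> carrier R. \<exists>y\<in>?K. y \<oplus>\<^bsub>M\<^esub> r \<odot>\<^bsub>M\<^esub> x \<in> N i}" for i
  have Imono: "I i \<subseteq> I j" if "i \<le> j" for i j
    using insert.prems(4)[OF that] unfolding I_def by blast
  have "ideal (I i) R" for i
    unfolding I_def by (rule ideal_of_coefficients[OF K insert.prems(2) x])
  moreover have "I i \<subseteq> I j \<or> I j \<subseteq> I i" for i j
    using Imono[of i j] Imono[of j i] by linarith
  ultimately have "subset.chain {J. ideal J R} (range I)"
    unfolding subset_chain_def by blast
  then obtain n2 where n2: "\<Union>(range I) = I n2"
    using ideal_chain_is_trivial[of "range I"] by blast
  define n where "n = max n1 n2"
  have "N m \<subseteq> N n" if m: "m \<ge> n" for m
  proof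
    fix z assume z: "z \<in> N m"
    then obtain y r where y: "z = y \<oplus>\<^bsub>M\<^esub> r \<odot>\<^bsub>M\<^esub> x" "y \<in> ?K" "r \<in> carrier R" using T[of m] by blast
    then have "r \<in> I m" unfolding I_def using z by blast
    then have "r \<in> I n" using n2 Imono[of n2 n] unfolding n_def by auto
    then obtain y' where y': "y' \<in> ?K" "y' \<oplus>\<^bsub>M\<^esub> r \<odot>\<^bsub>M\<^esub> x \<in> N n" unfolding I_def by blast
    note cs = Kc[OF y(2)] Kc[OF y'(1)] smult_closed[OF y(3) x]
    have "y \<ominus>\<^bsub>M\<^esub> y' = z \<ominus>\<^bsub>M\<^esub> (y' \<oplus>\<^bsub>M\<^esub> r \<odot>\<^bsub>M\<^esub> x)"
    proof -
      have "z \<ominus>\<^bsub>M\<^esub> (y' \<oplus>\<^bsub>M\<^esub> r \<odot>\<^bsub>M\<^esub> x) = y \<oplus>\<^bsub>M\<^esub> (\<ominus>\<^bsub>M\<^esub> y' \<oplus>\<^bsub>M\<^esub> (r \<odot>\<^bsub>M\<^esub> x \<oplus>\<^bsub>M\<^esub> \<ominus>\<^bsub>M\<^esub> (r \<odot>\<^bsub>M\<^esub> x)))"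
        unfolding y(1) using cs by (simp add: a_minus_def M.minus_add M.a_ac del: M.r_neg)
      then show ?thesis using cs by (simp add: M.r_neg a_minus_def)
    qed
    moreover have "z \<ominus>\<^bsub>M\<^esub> (y' \<oplus>\<^bsub>M\<^esub> r \<odot>\<^bsub>M\<^esub> x) \<in> N m"
      unfolding a_minus_def
      by (rule NE(5)[OF z NE(3)[OF subsetD[OF insert.prems(4)[OF m] y'(2)]]])
    moreover have "y \<ominus>\<^bsub>M\<^esub> y' \<in> ?K"
      unfolding a_minus_def by (rule KE(5)[OF y(2) KE(3)[OF y'(1)]])
    ultimately have "y \<ominus>\<^bsub>M\<^esub> y' \<in> N m \<inter> ?K" by simp
    also have "\<dots> = N n \<inter> ?K"
    proof -
      have "n1 \<le> n" "n1 \<le> m" using m unfolding n_def by simp_all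
      then show ?thesis using n1 by metis
    qed
    finally have "(y \<ominus>\<^bsub>M\<^esub> y') \<oplus>\<^bsub>M\<^esub> (y' \<oplus>\<^bsub>M\<^esub> r \<odot>\<^bsub>M\<^esub> x) \<in> N n"
      using NE(5)[OF _ y'(2)] by blast
    moreover have "(y \<ominus>\<^bsub>M\<^esub> y') \<oplus>\<^bsub>M\<^esub> (y' \<oplus>\<^bsub>M\<^esub> r \<odot>\<^bsub>M\<^esub> x) = z"
    proof -
      have "(y \<ominus>\<^bsub>M\<^esub> y') \<oplus>\<^bsub>M\<^esub> (y' \<oplus>\<^bsub>M\<^esub> r \<odot>\<^bsub>M\<^esub> x) = y \<oplus>\<^bsub>M\<^esub> ((\<ominus>\<^bsub>M\<^esub> y' \<oplus>\<^bsub>M\<^esub> y') \<oplus>\<^bsub>M\<^esub> r \<odot>\<^bsub>M\<^esub> x)"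
        using cs by (simp add: a_minus_def M.a_assoc)
      then show ?thesis using cs y(1) by (simp add: M.l_neg)
    qed
    ultimately show "z \<in> N n" by simp
  qed
  then show ?case using insert.prems(4) by (intro exI[of _ n]) blast
qed

end

theorem submodule_chain_stabilizes:
  assumes "noetherian_ring R" and "fin_gen_module R M"
    and "\<And>i. submodule (N i) R M" and "\<And>i j. i \<le> j \<Longrightarrow> N i \<subseteq> N (j::nat)"
  shows "\<exists>n. \<forall>m\<ge>n. N m = N n"
proof -
  interpret module R M using assms(2) by (simp add: fin_gen_module_def)
  obtain X where X: "finite X" "X \<subseteq> carrier M" "(\<lambda>H. submodule H R M) hull X = carrier M"
    using assms(2) unfolding fin_gen_module_def by blast
  show ?thesis
    by (rule chain_in_hull_stabilizes[OF assms(1) X(1,2) assms(3)])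
      (use X(3) submoduleE(1)[OF assms(3)] assms(4) in auto)
qed

section \<open>Localization of modules at a prime\<close>

locale module_at_prime = module R M + primeideal \<eta> R
  for R :: "'a ring" (structure) and M :: "('a, 'm) module" and \<eta> :: "'a set"
begin

definition Den :: "'a set" where "Den = carrier R - \<eta>"

lemma Den_carrier [simp]: "s \<in> Den \<Longrightarrow> s \<in> carrier R"
  by (simp add: Den_def)

lemma one_in_Den [simp]: "\<one> \<in> Den"
  using I_notcarr one_imp_carrier by (auto simp: Den_def)

lemma mult_in_Den [simp]: "s \<in> Den \<Longrightarrow> t \<in> Den \<Longrightarrow> s \<otimes> t \<in> Den"
  using I_prime by (auto simp: Den_def)

lemma pow_in_Den [simp]: "s \<in> Den \<Longrightarrow> s [^] (n::nat) \<in> Den"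
  by (induction n) simp_all

lemma mem_fraction_iff:
  "(y, t) \<in> fraction R M \<eta> x s \<longleftrightarrow> y \<in> carrier M \<and> t \<in> Den \<and>
     (\<exists>u\<in>Den. u \<odot>\<^bsub>M\<^esub> (t \<odot>\<^bsub>M\<^esub> x) = u \<odot>\<^bsub>M\<^esub> (s \<odot>\<^bsub>M\<^esub> y))"
  by (simp add: fraction_def Den_def)

lemma smult_smult:
  "a \<in> carrier R \<Longrightarrow> b \<in> carrier R \<Longrightarrow> x \<in> carrier M \<Longrightarrow> a \<odot>\<^bsub>M\<^esub> (b \<odot>\<^bsub>M\<^esub> x) = (a \<otimes> b) \<odot>\<^bsub>M\<^esub> x"
  by (simp add: smult_assoc1)

lemma fraction_eqI:
  assumes "x \<in> carrier M" "y \<in> carrier M" "s \<in> Den" "t \<in> Den" "u \<in> Den"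
    and "u \<odot>\<^bsub>M\<^esub> (t \<odot>\<^bsub>M\<^esub> x) = u \<odot>\<^bsub>M\<^esub> (s \<odot>\<^bsub>M\<^esub> y)"
  shows "fraction R M \<eta> x s = fraction R M \<eta> y t"
proof -
  have *: "fraction R M \<eta> y t \<subseteq> fraction R M \<eta> x s"
    if as: "x \<in> carrier M" "y \<in> carrier M" "s \<in> Den" "t \<in> Den" "u \<in> Den"
      "u \<odot>\<^bsub>M\<^esub> (t \<odot>\<^bsub>M\<^esub> x) = u \<odot>\<^bsub>M\<^esub> (s \<odot>\<^bsub>M\<^esub> y)" for x y s t
  proof
    fix Z assume Z: "Z \<in> fraction R M \<eta> y t"
    then obtain z r v where z: "Z = (z, r)" "z \<in> carrier M" "r \<in> Den" "v \<in> Den"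
      "v \<odot>\<^bsub>M\<^esub> (r \<odot>\<^bsub>M\<^esub> y) = v \<odot>\<^bsub>M\<^esub> (t \<odot>\<^bsub>M\<^esub> z)"
      by (cases Z) (auto simp: mem_fraction_iff)
    note cs = as(1-2) z(2) as(3-5)[THEN Den_carrier] z(3,4)[THEN Den_carrier]
    have e1: "(u \<otimes> t) \<odot>\<^bsub>M\<^esub> x = (u \<otimes> s) \<odot>\<^bsub>M\<^esub> y"
      using as(6) cs by (simp add: smult_assoc1)
    have e2: "(v \<otimes> r) \<odot>\<^bsub>M\<^esub> y = (v \<otimes> t) \<odot>\<^bsub>M\<^esub> z"
      using z(5) cs by (simp add: smult_assoc1)
    have "(v \<otimes> u \<otimes> t) \<odot>\<^bsub>M\<^esub> (r \<odot>\<^bsub>M\<^esub> x) = (v \<otimes> r) \<odot>\<^bsub>M\<^esub> ((u \<otimes> t) \<odot>\<^bsub>M\<^esub> x)"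
      using cs by (simp add: smult_smult R.m_ac)
    also have "\<dots> = (u \<otimes> s) \<odot>\<^bsub>M\<^esub> ((v \<otimes> r) \<odot>\<^bsub>M\<^esub> y)"
      unfolding e1 using cs by (simp add: smult_smult R.m_ac)
    also have "\<dots> = (v \<otimes> u \<otimes> t) \<odot>\<^bsub>M\<^esub> (s \<odot>\<^bsub>M\<^esub> z)"
      unfolding e2 using cs by (simp add: smult_smult R.m_ac)
    finally have "(v \<otimes> u \<otimes> t) \<odot>\<^bsub>M\<^esub> (r \<odot>\<^bsub>M\<^esub> x) = (v \<otimes> u \<otimes> t) \<odot>\<^bsub>M\<^esub> (s \<odot>\<^bsub>M\<^esub> z)" .
    moreover have "v \<otimes> u \<otimes> t \<in> Den" using as z by (intro mult_in_Den)
    ultimately show "Z \<in> fraction R M \<eta> x s"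
      unfolding mem_fraction_iff z(1) using z(2,3) by blast
  qed
  show ?thesis
    using *[OF assms] *[OF assms(2,1,4,3,5) assms(6)[symmetric]] by blast
qed

lemma mem_fraction_self: "x \<in> carrier M \<Longrightarrow> s \<in> Den \<Longrightarrow> (x, s) \<in> fraction R M \<eta> x s"
  unfolding mem_fraction_iff using one_in_Den by auto

lemma mem_fractionD:
  assumes "(y, t) \<in> fraction R M \<eta> x s"
  obtains u where "y \<in> carrier M" "t \<in> Den" "u \<in> Den"
    "u \<odot>\<^bsub>M\<^esub> (t \<odot>\<^bsub>M\<^esub> x) = u \<odot>\<^bsub>M\<^esub> (s \<odot>\<^bsub>M\<^esub> y)"
  using assms unfolding mem_fraction_iff by blast

lemma fraction_eqD:
  assumes "x \<in> carrier M" "s \<in> Den" "fraction R M \<eta> x s = fraction R M \<eta> y t"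
  obtains u where "u \<in> Den" "u \<odot>\<^bsub>M\<^esub> (t \<odot>\<^bsub>M\<^esub> x) = u \<odot>\<^bsub>M\<^esub> (s \<odot>\<^bsub>M\<^esub> y)"
proof -
  from mem_fraction_self[OF assms(1,2)]
  obtain u where "u \<in> Den" "u \<odot>\<^bsub>M\<^esub> (s \<odot>\<^bsub>M\<^esub> y) = u \<odot>\<^bsub>M\<^esub> (t \<odot>\<^bsub>M\<^esub> x)"
    unfolding assms(3) mem_fraction_iff by blast
  then show thesis by (intro that[of u]) simp_all
qed

text \<open>The operations of the localization are unions over all representatives of a fraction; they can be
  computed on one representative as soon as the summands do not depend on it.\<close>

lemma UN_fraction:
  assumes "x \<in> carrier M" "s \<in> Den"
    and "\<And>y t. (y, t) \<in> fraction R M \<eta> x s \<Longrightarrow> g y t = g x s"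
  shows "(\<Union>(y, t)\<in>fraction R M \<eta> x s. g y t) = g x s"
proof -
  have "(\<Union>(y, t)\<in>fraction R M \<eta> x s. g y t) = (\<Union>z\<in>fraction R M \<eta> x s. g x s)"
    by (rule SUP_cong[OF refl]) (clarsimp simp only: prod.case assms(3))
  then show ?thesis
    using mem_fraction_self[OF assms(1,2)] by (auto simp only: UN_constant split: if_splits)
qed

lemma carrier_localize:
  "carrier (localize R M \<eta>) = {fraction R M \<eta> x s | x s. x \<in> carrier M \<and> s \<in> Den}"
  by (simp add: localize_def Den_def)

lemma zero_localize: "\<zero>\<^bsub>localize R M \<eta>\<^esub> = fraction R M \<eta> \<zero>\<^bsub>M\<^esub> \<one>"
  by (simp add: localize_def)

lemma add_localize:
  "X \<oplus>\<^bsub>localize R M \<eta>\<^esub> Y = (\<Union>(x, s)\<in>X. \<Union>(y, t)\<in>Y.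
     fraction R M \<eta> (t \<odot>\<^bsub>M\<^esub> x \<oplus>\<^bsub>M\<^esub> s \<odot>\<^bsub>M\<^esub> y) (s \<otimes> t))"
  by (simp add: localize_def)

lemma smult_localize:
  "r \<odot>\<^bsub>localize R M \<eta>\<^esub> X = (\<Union>(x, s)\<in>X. fraction R M \<eta> (r \<odot>\<^bsub>M\<^esub> x) s)"
  by (simp add: localize_def)

lemma fraction_eq_zero_iff:
  assumes "x \<in> carrier M" "s \<in> Den"
  shows "fraction R M \<eta> x s = \<zero>\<^bsub>localize R M \<eta>\<^esub> \<longleftrightarrow> (\<exists>u\<in>Den. u \<odot>\<^bsub>M\<^esub> x = \<zero>\<^bsub>M\<^esub>)"
proof
  assume "fraction R M \<eta> x s = \<zero>\<^bsub>localize R M \<eta>\<^esub>"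
  then obtain u where "u \<in> Den" "u \<odot>\<^bsub>M\<^esub> (\<one> \<odot>\<^bsub>M\<^esub> x) = u \<odot>\<^bsub>M\<^esub> (s \<odot>\<^bsub>M\<^esub> \<zero>\<^bsub>M\<^esub>)"
    unfolding zero_localize using assms by (metis fraction_eqD)
  then show "\<exists>u\<in>Den. u \<odot>\<^bsub>M\<^esub> x = \<zero>\<^bsub>M\<^esub>" using assms by auto
next
  assume "\<exists>u\<in>Den. u \<odot>\<^bsub>M\<^esub> x = \<zero>\<^bsub>M\<^esub>"
  then obtain u where "u \<in> Den" "u \<odot>\<^bsub>M\<^esub> x = \<zero>\<^bsub>M\<^esub>" by blast
  then show "fraction R M \<eta> x s = \<zero>\<^bsub>localize R M \<eta>\<^esub>"
    unfolding zero_localize using assms by (intro fraction_eqI[where u = u]) simp_all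
qed

lemma add_fraction:
  assumes "x \<in> carrier M" "s \<in> Den" "y \<in> carrier M" "t \<in> Den"
  shows "fraction R M \<eta> x s \<oplus>\<^bsub>localize R M \<eta>\<^esub> fraction R M \<eta> y t =
    fraction R M \<eta> (t \<odot>\<^bsub>M\<^esub> x \<oplus>\<^bsub>M\<^esub> s \<odot>\<^bsub>M\<^esub> y) (s \<otimes> t)"
proof -
  have eq: "fraction R M \<eta> (t' \<odot>\<^bsub>M\<^esub> x' \<oplus>\<^bsub>M\<^esub> s' \<odot>\<^bsub>M\<^esub> y') (s' \<otimes> t') =
      fraction R M \<eta> (t \<odot>\<^bsub>M\<^esub> x \<oplus>\<^bsub>M\<^esub> s \<odot>\<^bsub>M\<^esub> y) (s \<otimes> t)"
    if mem: "(x', s') \<in> fraction R M \<eta> x s" "(y', t') \<in> fraction R M \<eta> y t" for x' s' y' t'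
  proof -
    obtain u where u: "x' \<in> carrier M" "s' \<in> Den" "u \<in> Den"
      "u \<odot>\<^bsub>M\<^esub> (s' \<odot>\<^bsub>M\<^esub> x) = u \<odot>\<^bsub>M\<^esub> (s \<odot>\<^bsub>M\<^esub> x')" using mem(1) by (rule mem_fractionD)
    obtain v where v: "y' \<in> carrier M" "t' \<in> Den" "v \<in> Den"
      "v \<odot>\<^bsub>M\<^esub> (t' \<odot>\<^bsub>M\<^esub> y) = v \<odot>\<^bsub>M\<^esub> (t \<odot>\<^bsub>M\<^esub> y')" using mem(2) by (rule mem_fractionD)
    note cs = u(1) v(1) assms(1,3) u(2,3)[THEN Den_carrier] v(2,3)[THEN Den_carrier]
      assms(2,4)[THEN Den_carrier]
    have "(u \<otimes> v) \<odot>\<^bsub>M\<^esub> ((s' \<otimes> t') \<odot>\<^bsub>M\<^esub> (t \<odot>\<^bsub>M\<^esub> x \<oplus>\<^bsub>M\<^esub> s \<odot>\<^bsub>M\<^esub> y)) =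
        (v \<otimes> t \<otimes> t') \<odot>\<^bsub>M\<^esub> (u \<odot>\<^bsub>M\<^esub> (s' \<odot>\<^bsub>M\<^esub> x)) \<oplus>\<^bsub>M\<^esub> (u \<otimes> s \<otimes> s') \<odot>\<^bsub>M\<^esub> (v \<odot>\<^bsub>M\<^esub> (t' \<odot>\<^bsub>M\<^esub> y))"
      using cs by (simp add: smult_smult smult_r_distr R.m_ac)
    also have "\<dots> = (u \<otimes> v) \<odot>\<^bsub>M\<^esub> ((s \<otimes> t) \<odot>\<^bsub>M\<^esub> (t' \<odot>\<^bsub>M\<^esub> x' \<oplus>\<^bsub>M\<^esub> s' \<odot>\<^bsub>M\<^esub> y'))"
      unfolding u(4) v(4) using cs by (simp add: smult_smult smult_r_distr R.m_ac)
    finally have *: "(u \<otimes> v) \<odot>\<^bsub>M\<^esub> ((s' \<otimes> t') \<odot>\<^bsub>M\<^esub> (t \<odot>\<^bsub>M\<^esub> x \<oplus>\<^bsub>M\<^esub> s \<odot>\<^bsub>M\<^esub> y)) = \<dots>" .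
    show ?thesis
      by (rule fraction_eqI[OF _ _ _ _ _ *[symmetric]]) (use cs u(2,3) v(2,3) assms in simp_all)
  qed
  define F where "F x' s' y' t' = fraction R M \<eta> (t' \<odot>\<^bsub>M\<^esub> x' \<oplus>\<^bsub>M\<^esub> s' \<odot>\<^bsub>M\<^esub> y') (s' \<otimes> t')"
    for x' s' y' t'
  have F: "F x' s' y' t' = F x s y t"
    if "(x', s') \<in> fraction R M \<eta> x s" "(y', t') \<in> fraction R M \<eta> y t" for x' s' y' t'
    using eq[OF that] unfolding F_def .
  have inner: "(\<Union>(y', t')\<in>fraction R M \<eta> y t. F x' s' y' t') = F x s y t"
    if mem: "(x', s') \<in> fraction R M \<eta> x s" for x' s'
    using UN_fraction[OF assms(3,4), of "F x' s'"] F[OF mem] mem_fraction_self[OF assms(3,4)]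
    by metis
  have "(\<Union>(x', s')\<in>fraction R M \<eta> x s. \<Union>(y', t')\<in>fraction R M \<eta> y t. F x' s' y' t') = F x s y t"
    using UN_fraction[OF assms(1,2), of "\<lambda>x' s'. \<Union>(y', t')\<in>fraction R M \<eta> y t. F x' s' y' t'"]
      inner mem_fraction_self[OF assms(1,2)]
    by metis
  then show ?thesis
    unfolding add_localize F_def .
qed

lemma smult_fraction:
  assumes "x \<in> carrier M" "s \<in> Den" "r \<in> carrier R"
  shows "r \<odot>\<^bsub>localize R M \<eta>\<^esub> fraction R M \<eta> x s = fraction R M \<eta> (r \<odot>\<^bsub>M\<^esub> x) s"
proof -
  have "(\<Union>(y, t)\<in>fraction R M \<eta> x s. fraction R M \<eta> (r \<odot>\<^bsub>M\<^esub> y) t) = fraction R M \<eta> (r \<odot>\<^bsub>M\<^esub> x) s"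
  proof (rule UN_fraction)
    fix y t assume "(y, t) \<in> fraction R M \<eta> x s"
    then obtain u where u: "y \<in> carrier M" "t \<in> Den" "u \<in> Den"
      "u \<odot>\<^bsub>M\<^esub> (t \<odot>\<^bsub>M\<^esub> x) = u \<odot>\<^bsub>M\<^esub> (s \<odot>\<^bsub>M\<^esub> y)" by (rule mem_fractionD)
    note cs = u(1) assms(1,3) u(2,3)[THEN Den_carrier] assms(2)[THEN Den_carrier]
    have "u \<odot>\<^bsub>M\<^esub> (t \<odot>\<^bsub>M\<^esub> (r \<odot>\<^bsub>M\<^esub> x)) = r \<odot>\<^bsub>M\<^esub> (u \<odot>\<^bsub>M\<^esub> (t \<odot>\<^bsub>M\<^esub> x))"
      using cs by (simp add: smult_smult R.m_ac)
    also have "\<dots> = u \<odot>\<^bsub>M\<^esub> (s \<odot>\<^bsub>M\<^esub> (r \<odot>\<^bsub>M\<^esub> y))"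
      unfolding u(4) using cs by (simp add: smult_smult R.m_ac)
    finally have *: "u \<odot>\<^bsub>M\<^esub> (t \<odot>\<^bsub>M\<^esub> (r \<odot>\<^bsub>M\<^esub> x)) = \<dots>" .
    show "fraction R M \<eta> (r \<odot>\<^bsub>M\<^esub> y) t = fraction R M \<eta> (r \<odot>\<^bsub>M\<^esub> x) s"
      by (rule fraction_eqI[OF _ _ _ _ _ *[symmetric]]) (use cs u assms in auto)
  qed (use assms in auto)
  then show ?thesis
    unfolding smult_localize .
qed

lemma fraction_in_localize:
  "x \<in> carrier M \<Longrightarrow> s \<in> Den \<Longrightarrow> fraction R M \<eta> x s \<in> carrier (localize R M \<eta>)"
  unfolding carrier_localize by blast

lemma neg_fraction:
  assumes "x \<in> carrier M" "s \<in> Den"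
  shows "fraction R M \<eta> (\<ominus>\<^bsub>M\<^esub> x) s \<oplus>\<^bsub>localize R M \<eta>\<^esub> fraction R M \<eta> x s = \<zero>\<^bsub>localize R M \<eta>\<^esub>"
proof -
  have "s \<odot>\<^bsub>M\<^esub> (\<ominus>\<^bsub>M\<^esub> x) \<oplus>\<^bsub>M\<^esub> s \<odot>\<^bsub>M\<^esub> x = \<zero>\<^bsub>M\<^esub>"
    using assms by (simp add: smult_r_minus M.l_neg)
  then have "fraction R M \<eta> (\<ominus>\<^bsub>M\<^esub> x) s \<oplus>\<^bsub>localize R M \<eta>\<^esub> fraction R M \<eta> x s =
      fraction R M \<eta> \<zero>\<^bsub>M\<^esub> (s \<otimes> s)"
    using assms by (simp add: add_fraction)
  moreover have "\<exists>u\<in>Den. u \<odot>\<^bsub>M\<^esub> \<zero>\<^bsub>M\<^esub> = \<zero>\<^bsub>M\<^esub>"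
    using one_in_Den by (intro bexI[of _ \<one>]) simp_all
  ultimately show ?thesis
    using assms by (simp only: fraction_eq_zero_iff[OF M.zero_closed mult_in_Den])
qed

lemma abelian_group_localize: "abelian_group (localize R M \<eta>)"
proof (rule abelian_groupI)
  let ?L = "localize R M \<eta>"
  show "\<zero>\<^bsub>?L\<^esub> \<in> carrier ?L"
    unfolding zero_localize by (intro fraction_in_localize one_in_Den) simp
  fix X assume "X \<in> carrier ?L"
  then obtain x s where X: "X = fraction R M \<eta> x s" "x \<in> carrier M" "s \<in> Den"
    unfolding carrier_localize by blast
  show "\<zero>\<^bsub>?L\<^esub> \<oplus>\<^bsub>?L\<^esub> X = X"
    using X unfolding zero_localize by (simp add: add_fraction one_in_Den)
  show "\<exists>Y\<in>carrier ?L. Y \<oplus>\<^bsub>?L\<^esub> X = \<zero>\<^bsub>?L\<^esub>"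
    using neg_fraction[OF X(2,3)] fraction_in_localize[of "\<ominus>\<^bsub>M\<^esub> x" s] X by blast
  fix Y assume "Y \<in> carrier ?L"
  then obtain y t where Y: "Y = fraction R M \<eta> y t" "y \<in> carrier M" "t \<in> Den"
    unfolding carrier_localize by blast
  note cs = X(2) Y(2) X(3)[THEN Den_carrier] Y(3)[THEN Den_carrier]
  show "X \<oplus>\<^bsub>?L\<^esub> Y \<in> carrier ?L"
    using X Y cs by (simp add: add_fraction fraction_in_localize mult_in_Den)
  show "X \<oplus>\<^bsub>?L\<^esub> Y = Y \<oplus>\<^bsub>?L\<^esub> X"
    using X Y cs by (simp add: add_fraction M.a_comm R.m_comm)
  fix Z assume "Z \<in> carrier ?L"
  then obtain z r where Z: "Z = fraction R M \<eta> z r" "z \<in> carrier M" "r \<in> Den"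
    unfolding carrier_localize by blast
  note cs = cs Z(2) Z(3)[THEN Den_carrier]
  show "X \<oplus>\<^bsub>?L\<^esub> Y \<oplus>\<^bsub>?L\<^esub> Z = X \<oplus>\<^bsub>?L\<^esub> (Y \<oplus>\<^bsub>?L\<^esub> Z)"
    using X Y Z cs
    by (simp add: add_fraction mult_in_Den smult_r_distr smult_smult R.m_ac M.a_assoc)
qed

end

section \<open>Graded actions on a localization\<close>

text \<open>\<open>act e r\<close> is the operator \<open>\<phi>\<^sub>e r\<close> for a fixed additive \<open>\<phi>\<^sub>e\<close> satisfying
  \<open>a \<phi>\<^sub>e = \<phi>\<^sub>e a\<^bsup>p^e\<^esup>\<close>.\<close>

locale cartier_action = module R M
  for R :: "'a ring" (structure) and M :: "('a, 'm) module" +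
  fixes p :: nat and act :: "('a, 'm) graded_action"
  assumes p_pos: "p > 0"
    and act_closed [simp]: "r \<in> carrier R \<Longrightarrow> x \<in> carrier M \<Longrightarrow> act e r x \<in> carrier M"
    and act_add: "r \<in> carrier R \<Longrightarrow> x \<in> carrier M \<Longrightarrow> y \<in> carrier M \<Longrightarrow>
      act e r (x \<oplus>\<^bsub>M\<^esub> y) = act e r x \<oplus>\<^bsub>M\<^esub> act e r y"
    and act_smult: "r \<in> carrier R \<Longrightarrow> a \<in> carrier R \<Longrightarrow> x \<in> carrier M \<Longrightarrow>
      act e r (a \<odot>\<^bsub>M\<^esub> x) = act e (r \<otimes> a) x"
    and smult_act: "r \<in> carrier R \<Longrightarrow> a \<in> carrier R \<Longrightarrow> x \<in> carrier M \<Longrightarrow>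
      a \<odot>\<^bsub>M\<^esub> act e r x = act e (r \<otimes> a [^] (p ^ e)) x"
begin

lemma act_zero: "r \<in> carrier R \<Longrightarrow> act e r \<zero>\<^bsub>M\<^esub> = \<zero>\<^bsub>M\<^esub>"
  using act_smult[of r \<zero> "\<zero>\<^bsub>M\<^esub>" e] act_add[of r "\<zero>\<^bsub>M\<^esub>" "\<zero>\<^bsub>M\<^esub>" e]
  by (metis M.add.r_cancel_one' M.l_zero M.zero_closed act_closed)

lemma act_minus:
  assumes "r \<in> carrier R" "x \<in> carrier M"
  shows "act e r (\<ominus>\<^bsub>M\<^esub> x) = \<ominus>\<^bsub>M\<^esub> act e r x"
proof -
  have "act e r (\<ominus>\<^bsub>M\<^esub> x) \<oplus>\<^bsub>M\<^esub> act e r x = \<zero>\<^bsub>M\<^esub>"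
    using assms by (simp add: act_add[symmetric] act_zero M.l_neg)
  then show ?thesis
    using assms by (simp add: M.minus_equality)
qed

lemma pow_pred:
  assumes "a \<in> carrier R"
  shows "a [^] (p ^ e - 1) \<otimes> a = a [^] (p ^ e)"
proof -
  have "Suc (p ^ e - 1) = p ^ e" using p_pos by simp
  then show ?thesis using R.nat_pow_Suc[of a "p ^ e - 1"] by simp
qed

lemma cartier_action_submodule:
  assumes N: "submodule N R M" and stable: "\<And>e r x. r \<in> carrier R \<Longrightarrow> x \<in> N \<Longrightarrow> act e r x \<in> N"
  shows "cartier_action R (M\<lparr>carrier := N\<rparr>) p act"
proof -
  have sub: "x \<in> carrier M" if "x \<in> N" for x
    using submoduleE(1)[OF N] that by blast
  show ?thesis
    using submodule.submodule_is_module[OF N module_axioms] p_pos stable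
    by (intro cartier_action.intro cartier_action_axioms.intro)
      (simp_all add: sub act_add act_smult smult_act)
qed

end

text \<open>\<open>C_colon R act Z a\<close> is the colon \<open>(Z : C\<^sub>+\<^sup>a)\<close>: the elements which all products of \<open>a\<close> operators of
  positive degree send into \<open>Z\<close>.\<close>

primrec C_colon :: "'a ring \<Rightarrow> ('a, 'm) graded_action \<Rightarrow> 'm set \<Rightarrow> nat \<Rightarrow> 'm set" where
  "C_colon R act Z 0 = Z"
| "C_colon R act Z (Suc a) = {x. \<forall>e\<ge>1. \<forall>r\<in>carrier R. act e r x \<in> C_colon R act Z a}"

text \<open>Passing to the colon replaces the iterated formation of generated subgroups by a condition on single
  elements.\<close>

lemma C_plus_power_subset_imp_colon:
  "(C_plus R M act ^^ a) X \<subseteq> Z \<Longrightarrow> X \<subseteq> C_colon R act Z a"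
proof (induction a arbitrary: X)
  case (Suc a)
  have "(C_plus R M act ^^ a) (C_plus R M act X) \<subseteq> Z"
    using Suc.prems by (simp add: funpow_swap1)
  then have "C_plus R M act X \<subseteq> C_colon R act Z a" by (rule Suc.IH)
  moreover have "act e r x \<in> C_plus R M act X" if "e \<ge> 1" "r \<in> carrier R" "x \<in> X" for e r x
    unfolding C_plus_def using that by (intro generate.incl) blast
  ultimately show ?case by auto
qed simp

lemma (in cartier_action) submodule_colon:
  assumes Z: "submodule Z R M"
  shows "submodule (C_colon R act Z a \<inter> carrier M) R M"
proof (induction a)
  case 0
  have "Z \<inter> carrier M = Z" using submoduleE(1)[OF Z] by blast
  with Z show ?case by simp
next
  case (Suc a)
  show ?case
    by (rule submoduleI)
      (use submoduleE[OF Suc] submodule.smult_closed[OF Suc] subgroup.one_closed[OF submodule.axioms(1)[OF Suc]]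
        in \<open>auto simp: act_zero act_minus act_add act_smult\<close>)
qed

locale cartier_action_at_prime = cartier_action R M p act + module_at_prime R M \<eta>
  for R :: "'a ring" (structure) and M :: "('a, 'm) module" and p act \<eta>
begin

abbreviation L :: "('a, ('m \<times> 'a) set) module" where "L \<equiv> localize R M \<eta>"
abbreviation lact :: "('a, ('m \<times> 'a) set) graded_action" where
  "lact \<equiv> localize_act p R M \<eta> act"

lemma localize_act_fraction:
  assumes "x \<in> carrier M" "s \<in> Den" "r \<in> carrier R"
  shows "lact e r (fraction R M \<eta> x s) = fraction R M \<eta> (act e (r \<otimes> s [^] (p ^ e - 1)) x) s"
proof -
  let ?q = "p ^ e - 1"
  have "(\<Union>(y, t)\<in>fraction R M \<eta> x s. fraction R M \<eta> (act e r ((t [^] ?q) \<odot>\<^bsub>M\<^esub> y)) t) =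
      fraction R M \<eta> (act e r ((s [^] ?q) \<odot>\<^bsub>M\<^esub> x)) s"
  proof (rule UN_fraction)
    fix y t assume "(y, t) \<in> fraction R M \<eta> x s"
    then obtain u where u: "y \<in> carrier M" "t \<in> Den" "u \<in> Den"
      "u \<odot>\<^bsub>M\<^esub> (t \<odot>\<^bsub>M\<^esub> x) = u \<odot>\<^bsub>M\<^esub> (s \<odot>\<^bsub>M\<^esub> y)" by (rule mem_fractionD)
    note cs = u(1) assms(1,3) u(2,3)[THEN Den_carrier] assms(2)[THEN Den_carrier]
    \<comment> \<open>Chosen so that \<open>u t \<phi>(s\<^bsup>q-1\<^esup> x) = \<phi>(c (u t x))\<close> with \<open>q = p\<^sup>e\<close>, which brings the relation between
      the two fractions into play; the other fraction gives the same \<open>c\<close>.\<close>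
    define c where "c = u [^] ?q \<otimes> (t [^] ?q \<otimes> s [^] ?q)"
    have c: "c \<in> carrier R" using cs by (simp add: c_def)
    have pw: "t [^] (p ^ e) = t [^] ?q \<otimes> t" "u [^] (p ^ e) = u [^] ?q \<otimes> u"
      "s [^] (p ^ e) = s [^] ?q \<otimes> s"
      using cs by (simp_all only: pow_pred)
    have "u \<odot>\<^bsub>M\<^esub> (t \<odot>\<^bsub>M\<^esub> act e r ((s [^] ?q) \<odot>\<^bsub>M\<^esub> x)) = act e (r \<otimes> c) (u \<odot>\<^bsub>M\<^esub> (t \<odot>\<^bsub>M\<^esub> x))"
      using cs c unfolding c_def by (simp add: act_smult smult_act pw R.m_ac del: R.nat_pow_Suc)
    also have "\<dots> = u \<odot>\<^bsub>M\<^esub> (s \<odot>\<^bsub>M\<^esub> act e r ((t [^] ?q) \<odot>\<^bsub>M\<^esub> y))"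
      unfolding u(4) using cs c unfolding c_def
      by (simp add: act_smult smult_act pw R.m_ac del: R.nat_pow_Suc)
    finally have *: "u \<odot>\<^bsub>M\<^esub> (t \<odot>\<^bsub>M\<^esub> act e r ((s [^] ?q) \<odot>\<^bsub>M\<^esub> x)) = \<dots>" .
    show "fraction R M \<eta> (act e r ((t [^] ?q) \<odot>\<^bsub>M\<^esub> y)) t = fraction R M \<eta> (act e r ((s [^] ?q) \<odot>\<^bsub>M\<^esub> x)) s"
      by (rule fraction_eqI[OF _ _ _ _ _ *[symmetric]]) (use cs u assms in auto)
  qed (use assms in auto)
  then show ?thesis
    using assms by (simp add: localize_act_def act_smult)
qed

lemma localize_act_closed:
  assumes "X \<in> carrier L" "r \<in> carrier R"
  shows "lact e r X \<in> carrier L"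
  using assms unfolding carrier_localize
  by clarsimp (subst localize_act_fraction, simp_all, metis act_closed R.m_closed R.nat_pow_closed Den_carrier)

lemma localize_act_add:
  assumes "X \<in> carrier L" "Y \<in> carrier L" "r \<in> carrier R"
  shows "lact e r (X \<oplus>\<^bsub>L\<^esub> Y) = lact e r X \<oplus>\<^bsub>L\<^esub> lact e r Y"
proof -
  let ?q = "p ^ e - 1"
  obtain x s where X: "X = fraction R M \<eta> x s" "x \<in> carrier M" "s \<in> Den"
    using assms(1) unfolding carrier_localize by blast
  obtain y t where Y: "Y = fraction R M \<eta> y t" "y \<in> carrier M" "t \<in> Den"
    using assms(2) unfolding carrier_localize by blast
  note cs = X(2) Y(2) assms(3) X(3)[THEN Den_carrier] Y(3)[THEN Den_carrier]
  have pw: "t [^] (p ^ e) = t [^] ?q \<otimes> t" "s [^] (p ^ e) = s [^] ?q \<otimes> s"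
    using cs by (simp_all only: pow_pred)
  show ?thesis
    using X Y cs
    by (simp add: add_fraction localize_act_fraction act_add act_smult smult_act pw
        R.nat_pow_distrib R.m_ac)
qed

end

section \<open>Nil-isomorphisms after localization\<close>

locale cartier_pair_at_prime = cartier_action_at_prime R M p act \<eta>
  for R :: "'a ring" (structure) and M :: "('a, 'm) module" and p act \<eta> +
  fixes N :: "'m set"
  assumes N_submodule: "submodule N R M"
    and N_stable: "r \<in> carrier R \<Longrightarrow> x \<in> N \<Longrightarrow> act e r x \<in> N"
begin

abbreviation K :: "('a, 'm) module" where "K \<equiv> M\<lparr>carrier := N\<rparr>"
abbreviation incl :: "('m \<times> 'a) set \<Rightarrow> ('m \<times> 'a) set" where
  "incl \<equiv> localize_map R M \<eta> (\<lambda>x. x)"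

definition image_N :: "('m \<times> 'a) set set" where
  "image_N = {fraction R M \<eta> x s | x s. x \<in> N \<and> s \<in> Den}"

definition saturation :: "'m set" where
  "saturation = {x \<in> carrier M. \<exists>u\<in>Den. u \<odot>\<^bsub>M\<^esub> x \<in> N}"

lemma N_carrier [simp]: "x \<in> N \<Longrightarrow> x \<in> carrier M"
  using submoduleE(1)[OF N_submodule] by blast

lemma N_add: "x \<in> N \<Longrightarrow> y \<in> N \<Longrightarrow> x \<oplus>\<^bsub>M\<^esub> y \<in> N"
  using submoduleE(5)[OF N_submodule] by blast

lemma N_minus: "x \<in> N \<Longrightarrow> \<ominus>\<^bsub>M\<^esub> x \<in> N"
  using submoduleE(3)[OF N_submodule] by blast

lemma N_smult: "r \<in> carrier R \<Longrightarrow> x \<in> N \<Longrightarrow> r \<odot>\<^bsub>M\<^esub> x \<in> N"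
  using submoduleE(4)[OF N_submodule] by blast

lemma N_zero: "\<zero>\<^bsub>M\<^esub> \<in> N"
  using subgroup.one_closed[OF submodule.axioms(1)[OF N_submodule]] by simp

lemma K_at_prime: "cartier_action_at_prime R K p act \<eta>"
  using cartier_action_submodule[OF N_submodule N_stable] cartier_action.axioms(1)
    module_at_prime_axioms
  unfolding cartier_action_at_prime_def module_at_prime_def by blast

lemma localize_map_fraction:
  assumes "x \<in> N" "s \<in> Den"
  shows "incl (fraction R K \<eta> x s) = fraction R M \<eta> x s"
proof -
  interpret K: cartier_action_at_prime R K p act \<eta> by (rule K_at_prime)
  have "(\<Union>(y, t)\<in>fraction R K \<eta> x s. fraction R M \<eta> y t) = fraction R M \<eta> x s"
  proof (rule K.UN_fraction)
    fix y t assume "(y, t) \<in> fraction R K \<eta> x s"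
    then obtain u where u: "y \<in> N" "t \<in> Den" "u \<in> Den"
      "u \<odot>\<^bsub>M\<^esub> (t \<odot>\<^bsub>M\<^esub> x) = u \<odot>\<^bsub>M\<^esub> (s \<odot>\<^bsub>M\<^esub> y)" unfolding K.mem_fraction_iff by auto
    then show "fraction R M \<eta> y t = fraction R M \<eta> x s"
      using assms by (intro fraction_eqI[OF _ _ _ _ _ u(4)[symmetric]]) auto
  qed (use assms in auto)
  then show ?thesis by (simp add: localize_map_def)
qed

lemma incl_image: "incl ` carrier (localize R K \<eta>) = image_N"
proof -
  interpret K: cartier_action_at_prime R K p act \<eta> by (rule K_at_prime)
  have "incl ` carrier (localize R K \<eta>) = {incl (fraction R K \<eta> x s) | x s. x \<in> N \<and> s \<in> Den}"
    unfolding K.carrier_localize by auto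
  also have "\<dots> = image_N"
    unfolding image_N_def by (intro Collect_cong iff_exI) (auto simp: localize_map_fraction)
  finally show ?thesis .
qed

lemma C_linear_incl:
  "C_linear R (localize R K \<eta>) (localize_act p R K \<eta> act) L lact incl"
proof -
  interpret K: cartier_action_at_prime R K p act \<eta> by (rule K_at_prime)
  have frac: "(\<And>x s. x \<in> N \<Longrightarrow> s \<in> Den \<Longrightarrow> P (fraction R K \<eta> x s)) \<Longrightarrow>
      \<forall>X\<in>carrier (localize R K \<eta>). P X" for P
    unfolding K.carrier_localize by auto
  have "incl \<in> carrier (localize R K \<eta>) \<rightarrow> carrier L"
  proof -
    have "\<forall>X\<in>carrier (localize R K \<eta>). incl X \<in> carrier L"
      by (rule frac) (simp add: localize_map_fraction fraction_in_localize)
    then show ?thesis by blast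
  qed
  moreover have "\<forall>X\<in>carrier (localize R K \<eta>). \<forall>Y\<in>carrier (localize R K \<eta>).
      incl (X \<oplus>\<^bsub>localize R K \<eta>\<^esub> Y) = incl X \<oplus>\<^bsub>L\<^esub> incl Y"
  proof (rule frac, rule frac)
    fix x s y t assume "x \<in> N" "s \<in> Den" "y \<in> N" "t \<in> Den"
    then show "incl (fraction R K \<eta> x s \<oplus>\<^bsub>localize R K \<eta>\<^esub> fraction R K \<eta> y t) =
        incl (fraction R K \<eta> x s) \<oplus>\<^bsub>L\<^esub> incl (fraction R K \<eta> y t)"
      using K.add_fraction[of x s y t]
      by (simp add: add_fraction localize_map_fraction N_add N_smult)
  qed
  moreover have "incl (r \<odot>\<^bsub>localize R K \<eta>\<^esub> X) = r \<odot>\<^bsub>L\<^esub> incl X"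
    if r: "r \<in> carrier R" and X: "X \<in> carrier (localize R K \<eta>)" for r X
  proof -
    obtain x s where "x \<in> N" "s \<in> Den" "X = fraction R K \<eta> x s"
      using X unfolding K.carrier_localize by auto
    then show ?thesis
      using r K.smult_fraction[of x s r] by (simp add: smult_fraction localize_map_fraction N_smult)
  qed
  moreover have "incl (localize_act p R K \<eta> act e r X) = lact e r (incl X)"
    if r: "r \<in> carrier R" and X: "X \<in> carrier (localize R K \<eta>)" for e r X
  proof -
    obtain x s where "x \<in> N" "s \<in> Den" "X = fraction R K \<eta> x s"
      using X unfolding K.carrier_localize by auto
    then show ?thesis
      using r K.localize_act_fraction[of x s r]
      by (simp add: localize_act_fraction localize_map_fraction N_stable)
  qed
  ultimately show ?thesis
    unfolding C_linear_def linear_map_def by blast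
qed

lemma incl_kernel: "a_kernel (localize R K \<eta>) L incl = {\<zero>\<^bsub>localize R K \<eta>\<^esub>}"
proof -
  interpret K: cartier_action_at_prime R K p act \<eta> by (rule K_at_prime)
  have "incl X = \<zero>\<^bsub>L\<^esub> \<longleftrightarrow> X = \<zero>\<^bsub>localize R K \<eta>\<^esub>" if X: "X \<in> carrier (localize R K \<eta>)" for X
  proof -
    obtain x s where "x \<in> N" "s \<in> Den" "X = fraction R K \<eta> x s"
      using X unfolding K.carrier_localize by auto
    then show ?thesis
      using fraction_eq_zero_iff[of x s] K.fraction_eq_zero_iff[of x s]
      by (simp add: localize_map_fraction)
  qed
  moreover have "\<zero>\<^bsub>localize R K \<eta>\<^esub> \<in> carrier (localize R K \<eta>)"
    using abelian_group.axioms(1)[OF K.abelian_group_localize] abelian_monoid.zero_closed by blast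
  ultimately show ?thesis
    unfolding a_kernel_def kernel_def by auto
qed

lemma kernel_nilpotent:
  "nilpotent R ((localize R K \<eta>)\<lparr>carrier := a_kernel (localize R K \<eta>) L incl\<rparr>) act'"
  unfolding nilpotent_def by (rule exI[of _ 0]) (simp add: incl_kernel)

lemma fraction_in_image_iff:
  assumes "x \<in> carrier M" "s \<in> Den"
  shows "fraction R M \<eta> x s \<in> image_N \<longleftrightarrow> x \<in> saturation"
proof
  assume "fraction R M \<eta> x s \<in> image_N"
  then obtain y t where y: "y \<in> N" "t \<in> Den" "fraction R M \<eta> x s = fraction R M \<eta> y t"
    unfolding image_N_def by blast
  obtain u where "u \<in> Den" "u \<odot>\<^bsub>M\<^esub> (t \<odot>\<^bsub>M\<^esub> x) = u \<odot>\<^bsub>M\<^esub> (s \<odot>\<^bsub>M\<^esub> y)"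
    using fraction_eqD[OF assms y(3)] by blast
  then have "(u \<otimes> t) \<odot>\<^bsub>M\<^esub> x \<in> N" "u \<otimes> t \<in> Den"
    using y assms by (simp_all add: smult_assoc1 N_smult)
  then show "x \<in> saturation" unfolding saturation_def using assms by blast
next
  assume "x \<in> saturation"
  then obtain u where u: "u \<in> Den" "u \<odot>\<^bsub>M\<^esub> x \<in> N" unfolding saturation_def by blast
  have "fraction R M \<eta> x s = fraction R M \<eta> (u \<odot>\<^bsub>M\<^esub> x) (u \<otimes> s)"
    using assms u by (intro fraction_eqI[where u = \<one>]) (simp_all add: smult_smult R.m_ac)
  moreover have "u \<otimes> s \<in> Den" using u assms by simp
  ultimately show "fraction R M \<eta> x s \<in> image_N"
    unfolding image_N_def using u by blast
qed

lemma saturation_carrier: "saturation \<subseteq> carrier M"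
  by (auto simp: saturation_def)

lemma N_subset_saturation: "N \<subseteq> saturation"
  unfolding saturation_def using one_in_Den by (auto intro!: bexI[of _ \<one>])

lemma saturation_submodule: "submodule saturation R M"
proof (rule submoduleI)
  show "saturation \<subseteq> carrier M" by (rule saturation_carrier)
  show "\<zero>\<^bsub>M\<^esub> \<in> saturation" using N_zero N_subset_saturation by blast
  show "\<ominus>\<^bsub>M\<^esub> x \<in> saturation" if "x \<in> saturation" for x
    using that N_minus unfolding saturation_def by clarsimp (metis Den_carrier smult_r_minus)
  show "x \<oplus>\<^bsub>M\<^esub> y \<in> saturation" if xy: "x \<in> saturation" "y \<in> saturation" for x y
  proof -
    obtain u v where uv: "u \<in> Den" "u \<odot>\<^bsub>M\<^esub> x \<in> N" "v \<in> Den" "v \<odot>\<^bsub>M\<^esub> y \<in> N" "x \<in> carrier M" "y \<in> carrier M"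
      using xy unfolding saturation_def by blast
    have "(u \<otimes> v) \<odot>\<^bsub>M\<^esub> (x \<oplus>\<^bsub>M\<^esub> y) = v \<odot>\<^bsub>M\<^esub> (u \<odot>\<^bsub>M\<^esub> x) \<oplus>\<^bsub>M\<^esub> u \<odot>\<^bsub>M\<^esub> (v \<odot>\<^bsub>M\<^esub> y)"
      using uv by (simp add: smult_r_distr smult_smult R.m_ac)
    then have "(u \<otimes> v) \<odot>\<^bsub>M\<^esub> (x \<oplus>\<^bsub>M\<^esub> y) \<in> N" using uv by (simp add: N_add N_smult)
    moreover have "u \<otimes> v \<in> Den" using uv by simp
    ultimately show ?thesis unfolding saturation_def using uv by blast
  qed
  show "a \<odot>\<^bsub>M\<^esub> x \<in> saturation" if a: "a \<in> carrier R" and x: "x \<in> saturation" for a x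
  proof -
    obtain u where u: "u \<in> Den" "u \<odot>\<^bsub>M\<^esub> x \<in> N" "x \<in> carrier M"
      using x unfolding saturation_def by blast
    have "u \<odot>\<^bsub>M\<^esub> (a \<odot>\<^bsub>M\<^esub> x) = a \<odot>\<^bsub>M\<^esub> (u \<odot>\<^bsub>M\<^esub> x)"
      using u a by (simp add: smult_smult R.m_ac)
    then have "u \<odot>\<^bsub>M\<^esub> (a \<odot>\<^bsub>M\<^esub> x) \<in> N" using u a by (simp add: N_smult)
    then show ?thesis unfolding saturation_def using u a by blast
  qed
qed

lemma image_abelian_subgroup: "abelian_subgroup image_N L"
proof -
  interpret L: abelian_group L by (rule abelian_group_localize)
  have neg: "\<ominus>\<^bsub>L\<^esub> fraction R M \<eta> x s = fraction R M \<eta> (\<ominus>\<^bsub>M\<^esub> x) s" if "x \<in> carrier M" "s \<in> Den" for x s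
    using neg_fraction[OF that] that by (intro L.minus_equality) (simp_all add: fraction_in_localize)
  have "subgroup image_N (add_monoid L)"
  proof (rule L.add.subgroupI)
    show "image_N \<subseteq> carrier L" unfolding image_N_def using fraction_in_localize by fastforce
    show "image_N \<noteq> {}" unfolding image_N_def using N_zero one_in_Den by blast
    fix X assume "X \<in> image_N"
    then obtain x s where X: "x \<in> N" "s \<in> Den" "X = fraction R M \<eta> x s" unfolding image_N_def by blast
    show "\<ominus>\<^bsub>L\<^esub> X \<in> image_N"
      using X neg[of x s] N_minus[of x] unfolding image_N_def by auto
    fix Y assume "Y \<in> image_N"
    then obtain y t where Y: "y \<in> N" "t \<in> Den" "Y = fraction R M \<eta> y t" unfolding image_N_def by blast
    show "X \<oplus>\<^bsub>L\<^esub> Y \<in> image_N"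
      unfolding image_N_def X(3) Y(3) using X(1,2) Y(1,2)
      by (simp add: add_fraction) (metis N_add N_smult Den_carrier mult_in_Den)
  qed
  then show ?thesis
    by (intro abelian_subgroupI3 additive_subgroup.intro L.abelian_group_axioms)
qed

definition coker_class :: "'m \<Rightarrow> 'a \<Rightarrow> ('m \<times> 'a) set set" where
  "coker_class x s = image_N +>\<^bsub>L\<^esub> fraction R M \<eta> x s"

abbreviation Q :: "('a, ('m \<times> 'a) set set) module" where "Q \<equiv> quot_module L image_N"

lemma carrier_Q: "carrier Q = {coker_class x s | x s. x \<in> carrier M \<and> s \<in> Den}"
  by (auto simp: quot_module_def A_RCOSETS_def' carrier_localize coker_class_def)

lemma zero_Q: "\<zero>\<^bsub>Q\<^esub> = image_N"
  by (simp add: quot_module_def)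

lemma coker_class_zero_iff:
  assumes "x \<in> carrier M" "s \<in> Den"
  shows "coker_class x s = image_N \<longleftrightarrow> x \<in> saturation"
proof -
  interpret I: abelian_subgroup image_N L by (rule image_abelian_subgroup)
  have "coker_class x s = image_N \<longleftrightarrow> fraction R M \<eta> x s \<in> image_N"
    unfolding coker_class_def
    using I.a_coset_join1[OF _ _ I.a_subgroup] I.a_coset_join2[OF _ I.a_subgroup]
      fraction_in_localize[OF assms] by blast
  then show ?thesis using fraction_in_image_iff[OF assms] by simp
qed

lemma group_Q: "group (add_monoid Q)"
proof -
  interpret I: abelian_subgroup image_N L by (rule image_abelian_subgroup)
  show ?thesis
    using I.a_factorgroup_is_group
    by (simp add: group_def monoid_def group_axioms_def Units_def A_FactGroup_def FactGroup_def
        quot_module_def A_RCOSETS_def set_add_def)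
qed

lemma add_coker_class:
  assumes "x \<in> carrier M" "s \<in> Den" "y \<in> carrier M" "t \<in> Den"
  shows "coker_class x s \<oplus>\<^bsub>Q\<^esub> coker_class y t =
    coker_class (t \<odot>\<^bsub>M\<^esub> x \<oplus>\<^bsub>M\<^esub> s \<odot>\<^bsub>M\<^esub> y) (s \<otimes> t)"
proof -
  interpret I: abelian_subgroup image_N L by (rule image_abelian_subgroup)
  show ?thesis
    using I.a_rcos_sum[of "fraction R M \<eta> x s" "fraction R M \<eta> y t"] assms
    by (simp add: coker_class_def quot_module_def fraction_in_localize add_fraction)
qed

lemma inv_coker_class:
  assumes "x \<in> carrier M" "s \<in> Den"
  shows "inv\<^bsub>add_monoid Q\<^esub> coker_class x s = coker_class (\<ominus>\<^bsub>M\<^esub> x) s"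
proof -
  interpret Q: group "add_monoid Q" by (rule group_Q)
  have mem: "coker_class x s \<in> carrier Q" "coker_class (\<ominus>\<^bsub>M\<^esub> x) s \<in> carrier Q"
    unfolding carrier_Q using assms by blast+
  have "s \<odot>\<^bsub>M\<^esub> (\<ominus>\<^bsub>M\<^esub> x) \<oplus>\<^bsub>M\<^esub> s \<odot>\<^bsub>M\<^esub> x = \<zero>\<^bsub>M\<^esub>"
    using assms by (simp add: smult_r_minus M.l_neg)
  then have "coker_class (\<ominus>\<^bsub>M\<^esub> x) s \<oplus>\<^bsub>Q\<^esub> coker_class x s = coker_class \<zero>\<^bsub>M\<^esub> (s \<otimes> s)"
    using assms by (simp add: add_coker_class)
  also have "\<dots> = \<zero>\<^bsub>Q\<^esub>"
    unfolding zero_Q using assms N_zero N_subset_saturation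
    by (subst coker_class_zero_iff) auto
  finally show ?thesis using mem by (intro Q.inv_equality) simp_all
qed

text \<open>The action on the cokernel does not depend on representatives, since the localized action is additive
  and preserves the image of \<open>N\<close>.\<close>

lemma quot_act_coker_class:
  assumes "x \<in> carrier M" "s \<in> Den" "r \<in> carrier R"
  shows "quot_act L image_N lact e r (coker_class x s) =
    coker_class (act e (r \<otimes> s [^] (p ^ e - 1)) x) s"
proof -
  interpret I: abelian_subgroup image_N L by (rule image_abelian_subgroup)
  let ?X = "fraction R M \<eta> x s"
  have X: "?X \<in> carrier L" using assms by (simp add: fraction_in_localize)
  have lX: "lact e r ?X \<in> carrier L" using X assms by (simp add: localize_act_closed)
  have rep: "image_N +>\<^bsub>L\<^esub> lact e r Z = image_N +>\<^bsub>L\<^esub> lact e r ?X" if Z: "Z \<in> image_N +>\<^bsub>L\<^esub> ?X" for Z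
  proof -
    obtain H where H: "H \<in> image_N" "Z = H \<oplus>\<^bsub>L\<^esub> ?X" using Z unfolding a_r_coset_def' by blast
    obtain y t where y: "y \<in> N" "t \<in> Den" "H = fraction R M \<eta> y t"
      using H unfolding image_N_def by blast
    have lH: "lact e r H \<in> image_N"
      using y assms N_stable[of "r \<otimes> t [^] (p ^ e - 1)" y e] unfolding image_N_def
      by (auto simp: localize_act_fraction)
    have "lact e r Z = lact e r H \<oplus>\<^bsub>L\<^esub> lact e r ?X"
      unfolding H(2) using H(1) I.a_subset X assms(3) by (intro localize_act_add) auto
    then have "lact e r Z \<in> image_N +>\<^bsub>L\<^esub> lact e r ?X"
      using I.a_rcosI[OF lH I.a_subset lX] by simp
    then show ?thesis using I.a_repr_independence[OF _ lX I.a_subgroup] by simp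
  qed
  have self: "?X \<in> image_N +>\<^bsub>L\<^esub> ?X"
    using I.a_rcosI[OF additive_subgroup.zero_closed[OF I.is_additive_subgroup] I.a_subset X] X by simp
  have "(\<Union>Z\<in>image_N +>\<^bsub>L\<^esub> ?X. image_N +>\<^bsub>L\<^esub> lact e r Z) =
      (\<Union>Z\<in>image_N +>\<^bsub>L\<^esub> ?X. image_N +>\<^bsub>L\<^esub> lact e r ?X)"
    by (intro SUP_cong refl rep)
  also have "\<dots> = image_N +>\<^bsub>L\<^esub> lact e r ?X" using self by (auto simp only: UN_constant split: if_splits)
  finally show ?thesis
    using assms by (simp add: quot_act_def coker_class_def localize_act_fraction)
qed

text \<open>An operator sends \<open>x/1\<close> to \<open>\<phi>(x)/1\<close>, so an induction on \<open>a\<close> can stay with denominator one.\<close>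

lemma colon_if_coker_class:
  assumes "x \<in> carrier M"
    and "coker_class x \<one> \<in> C_colon R (quot_act L image_N lact) {image_N} a"
  shows "x \<in> C_colon R act saturation a"
  using assms
proof (induction a arbitrary: x)
  case 0
  then show ?case using coker_class_zero_iff[of x \<one>] by simp
next
  case (Suc a)
  have "act e r x \<in> C_colon R act saturation a" if "e \<ge> 1" "r \<in> carrier R" for e r
  proof -
    have "quot_act L image_N lact e r (coker_class x \<one>) \<in>
        C_colon R (quot_act L image_N lact) {image_N} a"
      using Suc.prems(2) that by simp
    then have "coker_class (act e r x) \<one> \<in> C_colon R (quot_act L image_N lact) {image_N} a"
      using that Suc.prems(1) by (simp add: quot_act_coker_class)
    then show ?thesis using that Suc.prems(1) by (intro Suc.IH) simp_all
  qed
  then show ?case by simp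
qed

text \<open>In the other direction all denominators occur.  They cost nothing, because \<open>\<phi> (x/s)\<close> is
  \<open>(\<phi> s\<^bsup>p^e-1\<^esup>)(x) / s\<close> and \<open>\<phi> s\<^bsup>p^e-1\<^esup>\<close> is again an operator of degree \<open>e\<close>.  The classes
  \<open>x/s\<close> with \<open>x\<close> in \<open>(Z : C\<^sub>+\<^sup>c)\<close>, \<open>Z\<close> the saturation of \<open>N\<close>, form a subgroup of the cokernel, so generating a
  subgroup does not lead out of them, and \<open>C\<^sub>+\<close> lowers \<open>c\<close> by one.\<close>

lemma C_plus_power_coker:
  assumes "X \<subseteq> {coker_class x s | x s. x \<in> C_colon R act saturation (a + b) \<inter> carrier M \<and> s \<in> Den}"
  shows "(C_plus R Q (quot_act L image_N lact) ^^ a) X \<subseteq>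
    {coker_class x s | x s. x \<in> C_colon R act saturation b \<inter> carrier M \<and> s \<in> Den}"
  using assms
proof (induction a arbitrary: X)
  case 0
  then show ?case by simp
next
  case (Suc a)
  let ?P = "\<lambda>c. {coker_class x s | x s. x \<in> C_colon R act saturation c \<inter> carrier M \<and> s \<in> Den}"
  let ?q = "quot_act L image_N lact"
  define c where "c = a + b"
  note sub = submoduleE[OF submodule_colon[OF saturation_submodule, of c]]
  have gen: "Z \<in> ?P c" if Zgen: "Z \<in> {?q e r W | e r W. e \<ge> 1 \<and> r \<in> carrier R \<and> W \<in> X}" for Z
  proof -
    obtain e r W where Z: "Z = ?q e r W" "e \<ge> 1" "r \<in> carrier R" "W \<in> X" using Zgen by blast
    obtain x s where x: "W = coker_class x s" "x \<in> C_colon R act saturation (Suc c)" "x \<in> carrier M" "s \<in> Den"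
      using Z(4) Suc.prems unfolding c_def by auto
    have "act e (r \<otimes> s [^] (p ^ e - 1)) x \<in> C_colon R act saturation c \<inter> carrier M"
      using x Z by simp
    moreover have "Z = coker_class (act e (r \<otimes> s [^] (p ^ e - 1)) x) s"
      using x Z by (simp add: quot_act_coker_class)
    ultimately show ?thesis using x(4) by blast
  qed
  have "C_plus R Q ?q X \<subseteq> ?P c"
  proof
    fix Z assume "Z \<in> C_plus R Q ?q X"
    then show "Z \<in> ?P c" unfolding C_plus_def
    proof (induction rule: generate.induct)
      case one
      have "\<zero>\<^bsub>M\<^esub> \<in> C_colon R act saturation c \<inter> carrier M"
        using subgroup.one_closed[OF submodule.axioms(1)[OF submodule_colon[OF saturation_submodule]]]
        by simp
      moreover have "\<one>\<^bsub>add_monoid Q\<^esub> = coker_class \<zero>\<^bsub>M\<^esub> \<one>"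
        using coker_class_zero_iff[of "\<zero>\<^bsub>M\<^esub>" \<one>] N_zero N_subset_saturation by (auto simp: zero_Q)
      ultimately show ?case using one_in_Den by blast
    next
      case (incl Z)
      then show ?case by (rule gen)
    next
      case (inv Z)
      obtain x s where x: "Z = coker_class x s" "x \<in> C_colon R act saturation c \<inter> carrier M" "s \<in> Den"
        using gen[OF inv] by blast
      have "inv\<^bsub>add_monoid Q\<^esub> Z = coker_class (\<ominus>\<^bsub>M\<^esub> x) s"
        unfolding x(1) using x by (intro inv_coker_class) auto
      then show ?case using sub(3)[OF x(2)] x(3) by blast
    next
      case (eng Z W)
      obtain x s where x: "Z = coker_class x s" "x \<in> C_colon R act saturation c \<inter> carrier M" "s \<in> Den"
        using eng.IH(1) by blast
      obtain y t where y: "W = coker_class y t" "y \<in> C_colon R act saturation c \<inter> carrier M" "t \<in> Den"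
        using eng.IH(2) by blast
      have "Z \<otimes>\<^bsub>add_monoid Q\<^esub> W = coker_class (t \<odot>\<^bsub>M\<^esub> x \<oplus>\<^bsub>M\<^esub> s \<odot>\<^bsub>M\<^esub> y) (s \<otimes> t)"
        unfolding x(1) y(1) using x y by (simp add: add_coker_class)
      moreover have "t \<odot>\<^bsub>M\<^esub> x \<oplus>\<^bsub>M\<^esub> s \<odot>\<^bsub>M\<^esub> y \<in> C_colon R act saturation c \<inter> carrier M"
        using x y by (intro sub(4,5)) simp_all
      moreover have "s \<otimes> t \<in> Den" using x y by simp
      ultimately show ?case by blast
    qed
  qed
  then have "(C_plus R Q ?q ^^ a) (C_plus R Q ?q X) \<subseteq> ?P b"
    unfolding c_def by (rule Suc.IH)
  then show ?case by (simp add: funpow_swap1)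
qed

text \<open>The kernel is zero by exactness of localization; only the nilpotency of the cokernel is a
  condition.\<close>

theorem nil_isomorphism_iff_colon:
  "nil_isomorphism R (localize R K \<eta>) (localize_act p R K \<eta> act) L lact incl \<longleftrightarrow>
     (\<exists>a. carrier M \<subseteq> C_colon R act saturation a)"
proof -
  let ?q = "quot_act L image_N lact"
  have "nilpotent R Q ?q \<longleftrightarrow> (\<exists>a. carrier M \<subseteq> C_colon R act saturation a)"
  proof
    assume "nilpotent R Q ?q"
    then obtain a where "(C_plus R Q ?q ^^ a) (carrier Q) \<subseteq> {image_N}"
      unfolding nilpotent_def zero_Q by blast
    then have "carrier Q \<subseteq> C_colon R ?q {image_N} a" by (rule C_plus_power_subset_imp_colon)
    then have "coker_class x \<one> \<in> C_colon R ?q {image_N} a" if "x \<in> carrier M" for x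
      using that one_in_Den unfolding carrier_Q by blast
    then show "\<exists>a. carrier M \<subseteq> C_colon R act saturation a"
      using colon_if_coker_class by blast
  next
    assume "\<exists>a. carrier M \<subseteq> C_colon R act saturation a"
    then obtain a where a: "carrier M \<subseteq> C_colon R act saturation (a + 0)" by auto
    have "(C_plus R Q ?q ^^ a) (carrier Q) \<subseteq>
        {coker_class x s | x s. x \<in> C_colon R act saturation 0 \<inter> carrier M \<and> s \<in> Den}"
      using a by (intro C_plus_power_coker) (auto simp: carrier_Q)
    also have "\<dots> \<subseteq> {\<zero>\<^bsub>Q\<^esub>}"
      using coker_class_zero_iff by (auto simp: zero_Q)
    finally have "(C_plus R Q ?q ^^ a) (carrier Q) \<subseteq> {\<zero>\<^bsub>Q\<^esub>}" .
    moreover have "\<zero>\<^bsub>Q\<^esub> \<in> (C_plus R Q ?q ^^ a) (carrier Q)"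
    proof (cases a)
      case 0
      then show ?thesis using group.is_monoid[OF group_Q] monoid.one_closed by fastforce
    next
      case (Suc b)
      then show ?thesis
        using generate.one[of "add_monoid Q"] by (simp add: C_plus_def)
    qed
    ultimately show "nilpotent R Q ?q" unfolding nilpotent_def by blast
  qed
  then show ?thesis
    unfolding nil_isomorphism_def incl_image using C_linear_incl kernel_nilpotent by simp
qed

text \<open>The induction uses \<open>c \<phi>(x) = (\<phi> c\<^bsup>p^e-1\<^esup>)(c x)\<close>, which turns a multiple of an image into an image
  of the multiple.\<close>

lemma colon_cancel_Den:
  assumes "c \<in> Den" "x \<in> carrier M" "c \<odot>\<^bsub>M\<^esub> x \<in> C_colon R act saturation a"
  shows "x \<in> C_colon R act saturation a"
  using assms(2,3)
proof (induction a arbitrary: x)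
  case 0
  then obtain u where "u \<in> Den" "(u \<otimes> c) \<odot>\<^bsub>M\<^esub> x \<in> N"
    using assms(1) unfolding saturation_def by (auto simp: smult_smult)
  then show ?case using 0 assms(1) unfolding saturation_def by auto
next
  case (Suc a)
  have "act e r x \<in> C_colon R act saturation a" if e: "e \<ge> 1" and r: "r \<in> carrier R" for e r
  proof (rule Suc.IH)
    show "act e r x \<in> carrier M" using r Suc.prems by simp
    have c: "c \<in> carrier R" using assms(1) by simp
    have "c \<odot>\<^bsub>M\<^esub> act e r x = act e (r \<otimes> c [^] (p ^ e - 1)) (c \<odot>\<^bsub>M\<^esub> x)"
      using r c Suc.prems(1) by (simp add: smult_act act_smult R.m_assoc
          pow_pred[unfolded One_nat_def])
    also have "\<dots> \<in> C_colon R act saturation a"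
      using Suc.prems(2) e r c by simp
    finally show "c \<odot>\<^bsub>M\<^esub> act e r x \<in> C_colon R act saturation a" .
  qed
  then show ?case by simp
qed

end

section \<open>Generic nil-isomorphisms\<close>

lemma (in cring) ideal_pow_is_ideal:
  assumes "ideal I R"
  shows "ideal (I [^]\<^bsub>ideals_set R\<^esub> (n::nat)) R"
proof -
  interpret S: comm_monoid "ideals_set R" by (rule ideals_set_is_comm_monoid)
  have "I [^]\<^bsub>ideals_set R\<^esub> n \<in> carrier (ideals_set R)"
    by (rule S.nat_pow_closed) (simp add: ideals_set_def assms)
  then show ?thesis by (simp add: ideals_set_def)
qed

lemma (in cring) ideal_pow_antimono:
  assumes "ideal I R" "m \<le> n"
  shows "I [^]\<^bsub>ideals_set R\<^esub> n \<subseteq> I [^]\<^bsub>ideals_set R\<^esub> (m::nat)"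
proof -
  interpret S: comm_monoid "ideals_set R" by (rule ideals_set_is_comm_monoid)
  have "I [^]\<^bsub>ideals_set R\<^esub> n = I [^]\<^bsub>ideals_set R\<^esub> m \<otimes>\<^bsub>ideals_set R\<^esub> I [^]\<^bsub>ideals_set R\<^esub> (n - m)"
    using S.nat_pow_mult[of I m "n - m"] assms by (simp add: ideals_set_def)
  also have "\<dots> = ideal_prod R (I [^]\<^bsub>ideals_set R\<^esub> m) (I [^]\<^bsub>ideals_set R\<^esub> (n - m))"
    by (simp add: ideals_set_def)
  finally show ?thesis
    using ideal_prod_inter[OF ideal_pow_is_ideal[OF assms(1), of m] ideal_pow_is_ideal[OF assms(1), of "n - m"]]
    by blast
qed

lemma mem_H0_iff:
  "x \<in> carrier (H0 R M \<eta>) \<longleftrightarrow>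
     x \<in> carrier M \<and> (\<exists>n::nat. \<forall>r \<in> \<eta> [^]\<^bsub>ideals_set R\<^esub> n. r \<odot>\<^bsub>M\<^esub> x = \<zero>\<^bsub>M\<^esub>)"
  by (simp add: H0_def)

lemma H0_submodule:
  fixes R (structure)
  assumes "module R M" and \<eta>: "ideal \<eta> R"
  shows "submodule (carrier (H0 R M \<eta>)) R M"
proof -
  interpret module R M by fact
  show ?thesis
  proof (rule submoduleI)
    let ?H = "carrier (H0 R M \<eta>)"
    have pow: "r \<in> carrier R" if "r \<in> \<eta> [^]\<^bsub>ideals_set R\<^esub> (n::nat)" for r n
      by (rule ideal.Icarr[OF R.ideal_pow_is_ideal[OF \<eta>] that])
    show "?H \<subseteq> carrier M" by (auto simp: mem_H0_iff)
    show "\<zero>\<^bsub>M\<^esub> \<in> ?H" using pow by (auto simp: mem_H0_iff)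
    show "\<ominus>\<^bsub>M\<^esub> x \<in> ?H" if x: "x \<in> ?H" for x
    proof -
      obtain n :: nat where n: "\<And>r. r \<in> \<eta> [^]\<^bsub>ideals_set R\<^esub> n \<Longrightarrow> r \<odot>\<^bsub>M\<^esub> x = \<zero>\<^bsub>M\<^esub>" "x \<in> carrier M"
        using x unfolding mem_H0_iff by blast
      have "r \<odot>\<^bsub>M\<^esub> (\<ominus>\<^bsub>M\<^esub> x) = \<zero>\<^bsub>M\<^esub>" if r: "r \<in> \<eta> [^]\<^bsub>ideals_set R\<^esub> n" for r
        using pow[OF r] n by (simp add: smult_r_minus n(1)[OF r])
      then show ?thesis using n(2) unfolding mem_H0_iff by blast
    qed
    show "a \<odot>\<^bsub>M\<^esub> x \<in> ?H" if a: "a \<in> carrier R" and x: "x \<in> ?H" for a x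
    proof -
      obtain n :: nat where n: "\<And>r. r \<in> \<eta> [^]\<^bsub>ideals_set R\<^esub> n \<Longrightarrow> r \<odot>\<^bsub>M\<^esub> x = \<zero>\<^bsub>M\<^esub>" "x \<in> carrier M"
        using x unfolding mem_H0_iff by blast
      have "r \<odot>\<^bsub>M\<^esub> (a \<odot>\<^bsub>M\<^esub> x) = \<zero>\<^bsub>M\<^esub>" if r: "r \<in> \<eta> [^]\<^bsub>ideals_set R\<^esub> n" for r
      proof -
        have "r \<odot>\<^bsub>M\<^esub> (a \<odot>\<^bsub>M\<^esub> x) = a \<odot>\<^bsub>M\<^esub> (r \<odot>\<^bsub>M\<^esub> x)"
          using pow[OF r] a n(2) by (simp add: smult_assoc1[symmetric] R.m_comm)
        then show ?thesis using a by (simp add: n(1)[OF r])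
      qed
      then show ?thesis using n(2) a unfolding mem_H0_iff by blast
    qed
    show "x \<oplus>\<^bsub>M\<^esub> y \<in> ?H" if x: "x \<in> ?H" and y: "y \<in> ?H" for x y
    proof -
      obtain n :: nat where n: "\<And>r. r \<in> \<eta> [^]\<^bsub>ideals_set R\<^esub> n \<Longrightarrow> r \<odot>\<^bsub>M\<^esub> x = \<zero>\<^bsub>M\<^esub>" "x \<in> carrier M"
        using x unfolding mem_H0_iff by blast
      obtain m :: nat where m: "\<And>r. r \<in> \<eta> [^]\<^bsub>ideals_set R\<^esub> m \<Longrightarrow> r \<odot>\<^bsub>M\<^esub> y = \<zero>\<^bsub>M\<^esub>" "y \<in> carrier M"
        using y unfolding mem_H0_iff by blast
      have "r \<odot>\<^bsub>M\<^esub> (x \<oplus>\<^bsub>M\<^esub> y) = \<zero>\<^bsub>M\<^esub>" if r: "r \<in> \<eta> [^]\<^bsub>ideals_set R\<^esub> (max n m)" for r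
      proof -
        have "r \<in> \<eta> [^]\<^bsub>ideals_set R\<^esub> n" "r \<in> \<eta> [^]\<^bsub>ideals_set R\<^esub> m"
          using r R.ideal_pow_antimono[OF \<eta>, of n "max n m"]
            R.ideal_pow_antimono[OF \<eta>, of m "max n m"] by auto
        then show ?thesis using n m pow[OF r] by (simp add: smult_r_distr)
      qed
      then show ?thesis using n(2) m(2) unfolding mem_H0_iff by blast
    qed
  qed
qed

context cartier_action
begin

text \<open>If \<open>a\<close> lies in \<open>\<eta>\<^sup>n\<close>, so does \<open>a\<^bsup>p^e\<^esup>\<close>, and \<open>a \<phi>(x) = \<phi>(a\<^bsup>p^e\<^esup> x)\<close>.\<close>

lemma H0_stable:
  assumes "ideal \<eta> R" and r: "r \<in> carrier R" and x: "x \<in> carrier (H0 R M \<eta>)"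
  shows "act e r x \<in> carrier (H0 R M \<eta>)"
proof -
  obtain n :: nat where n: "\<And>a. a \<in> \<eta> [^]\<^bsub>ideals_set R\<^esub> n \<Longrightarrow> a \<odot>\<^bsub>M\<^esub> x = \<zero>\<^bsub>M\<^esub>" "x \<in> carrier M"
    using x unfolding mem_H0_iff by blast
  interpret I: ideal "\<eta> [^]\<^bsub>ideals_set R\<^esub> n" R by (rule R.ideal_pow_is_ideal[OF assms(1)])
  have "a \<odot>\<^bsub>M\<^esub> act e r x = \<zero>\<^bsub>M\<^esub>" if a: "a \<in> \<eta> [^]\<^bsub>ideals_set R\<^esub> n" for a
  proof -
    have ac: "a \<in> carrier R" using a by (rule I.Icarr)
    have "a [^] (p ^ e - 1) \<otimes> a \<in> \<eta> [^]\<^bsub>ideals_set R\<^esub> n"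
      using a ac by (intro I.I_l_closed) simp_all
    then have "a [^] (p ^ e) \<odot>\<^bsub>M\<^esub> x = \<zero>\<^bsub>M\<^esub>"
      using n(1) by (simp only: pow_pred[OF ac])
    then have "act e r (a [^] (p ^ e) \<odot>\<^bsub>M\<^esub> x) = \<zero>\<^bsub>M\<^esub>" using r by (simp add: act_zero)
    then show ?thesis using r ac n(2) by (simp add: smult_act act_smult)
  qed
  then show ?thesis using n(2) r unfolding mem_H0_iff by auto
qed

text \<open>The elements of \<open>H\<^sup>0\<^sub>\<eta>(M)\<close> whose image in the localization at \<open>\<eta>\<close> comes from \<open>N\<close>.\<close>

definition generic_saturation :: "'a set \<Rightarrow> 'm set \<Rightarrow> 'm set" where
  "generic_saturation \<eta> N = {x \<in> carrier (H0 R M \<eta>). \<exists>u\<in>carrier R - \<eta>. u \<odot>\<^bsub>M\<^esub> x \<in> N}"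

lemma
  assumes \<eta>: "primeideal \<eta> R" and N: "C_submodule R M act N"
  shows H0_pair_at_prime:
      "cartier_pair_at_prime R (H0 R M \<eta>) p act \<eta> (N \<inter> carrier (H0 R M \<eta>))"
    and saturation_H0:
      "cartier_pair_at_prime.saturation R (H0 R M \<eta>) \<eta> (N \<inter> carrier (H0 R M \<eta>)) =
        generic_saturation \<eta> N"
proof -
  let ?G = "carrier (H0 R M \<eta>)"
  have \<eta>': "ideal \<eta> R" using \<eta> by (rule primeideal.axioms(1))
  note G = H0_submodule[OF module_axioms \<eta>'] and GE = submoduleE[OF H0_submodule[OF module_axioms \<eta>']]
  have N': "submodule N R M" "\<And>e r x. r \<in> carrier R \<Longrightarrow> x \<in> N \<Longrightarrow> act e r x \<in> N"
    using N unfolding C_submodule_def by auto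
  have H0: "H0 R M \<eta> = M\<lparr>carrier := ?G\<rparr>" by (simp add: H0_def)
  have ca: "cartier_action R (H0 R M \<eta>) p act"
    by (subst H0) (rule cartier_action_submodule[OF G H0_stable[OF \<eta>']])
  then have m: "module R (H0 R M \<eta>)" by (rule cartier_action.axioms)
  have sub: "submodule (N \<inter> ?G) R M"
    using submodule_Int_family[of "{N, ?G}"] N' G by auto
  have "submodule (N \<inter> ?G) R (H0 R M \<eta>)"
  proof (rule module.module_incl_imp_submodule[OF m])
    have "(H0 R M \<eta>)\<lparr>carrier := N \<inter> ?G\<rparr> = M\<lparr>carrier := N \<inter> ?G\<rparr>" by (simp add: H0_def)
    then show "module R ((H0 R M \<eta>)\<lparr>carrier := N \<inter> ?G\<rparr>)"
      using submodule.submodule_is_module[OF sub module_axioms] by simp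
  qed simp
  then show pair: "cartier_pair_at_prime R (H0 R M \<eta>) p act \<eta> (N \<inter> ?G)"
    using ca m \<eta> N'(2) H0_stable[OF \<eta>']
    by (intro cartier_pair_at_prime.intro cartier_action_at_prime.intro module_at_prime.intro
        cartier_pair_at_prime_axioms.intro) simp_all
  then interpret P: cartier_pair_at_prime R "H0 R M \<eta>" p act \<eta> "N \<inter> ?G" .
  have sm: "r \<odot>\<^bsub>H0 R M \<eta>\<^esub> x = r \<odot>\<^bsub>M\<^esub> x" for r x by (simp add: H0_def)
  show "P.saturation = generic_saturation \<eta> N"
    unfolding P.saturation_def generic_saturation_def P.Den_def sm
    using GE(4) by (intro Collect_cong conj_cong bex_cong refl) simp
qed

text \<open>The criterion for the inclusion of \<open>N \<inter> H\<^sup>0\<^sub>\<eta>(M)\<close>, which is \<open>H\<^sup>0\<^sub>\<eta>(N)\<close>, into \<open>H\<^sup>0\<^sub>\<eta>(M)\<close>.\<close>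

theorem generic_nil_iso_iff:
  assumes \<eta>: "primeideal \<eta> R" and N: "C_submodule R M act N"
  shows "generic_nil_iso p R M act \<eta> N \<longleftrightarrow>
    (\<exists>a. carrier (H0 R M \<eta>) \<subseteq> C_colon R act (generic_saturation \<eta> N) a)"
proof -
  interpret P: cartier_pair_at_prime R "H0 R M \<eta>" p act \<eta> "N \<inter> carrier (H0 R M \<eta>)"
    by (rule H0_pair_at_prime[OF assms])
  have "N \<subseteq> carrier M" using N submoduleE(1) unfolding C_submodule_def by blast
  then have "H0 R (M\<lparr>carrier := N\<rparr>) \<eta> = (H0 R M \<eta>)\<lparr>carrier := N \<inter> carrier (H0 R M \<eta>)\<rparr>"
    by (auto simp: H0_def intro!: arg_cong[where f = "\<lambda>C. M\<lparr>carrier := C\<rparr>"])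
  then show ?thesis
    unfolding generic_nil_iso_def Let_def using P.nil_isomorphism_iff_colon saturation_H0[OF assms]
    by simp
qed

lemma C_submodule_if_absorbs:
  assumes N: "submodule N R M" and zero: "\<And>r x. r \<in> carrier R \<Longrightarrow> x \<in> carrier M \<Longrightarrow> act 0 r x = r \<odot>\<^bsub>M\<^esub> x"
    and abs: "\<And>e r x. e \<ge> 1 \<Longrightarrow> r \<in> carrier R \<Longrightarrow> x \<in> carrier M \<Longrightarrow> act e r x \<in> N"
  shows "C_submodule R M act N"
proof -
  have "act e r x \<in> N" if "r \<in> carrier R" "x \<in> N" for e r x
  proof (cases "e = 0")
    case True
    then show ?thesis using that zero submoduleE(1,4)[OF N] by (metis subsetD)
  next
    case False
    then show ?thesis using that abs submoduleE(1)[OF N] by auto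
  qed
  with N show ?thesis unfolding C_submodule_def by blast
qed

text \<open>Here \<open>C\<^sub>+\<close> kills \<open>M / N\<close>, so the criterion holds with a single operator and denominator one.\<close>

lemma generic_nil_iso_if_absorbs:
  assumes \<eta>: "primeideal \<eta> R" and N: "C_submodule R M act N"
    and abs: "\<And>e r x. e \<ge> 1 \<Longrightarrow> r \<in> carrier R \<Longrightarrow> x \<in> carrier M \<Longrightarrow> act e r x \<in> N"
  shows "generic_nil_iso p R M act \<eta> N"
proof -
  interpret P: primeideal \<eta> R by (rule \<eta>)
  have one: "\<one> \<in> carrier R - \<eta>" using P.I_notcarr P.one_imp_carrier by auto
  have "act e r x \<in> generic_saturation \<eta> N"
    if "x \<in> carrier (H0 R M \<eta>)" "e \<ge> 1" "r \<in> carrier R" for x e r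
  proof -
    have x: "x \<in> carrier M" using that unfolding mem_H0_iff by blast
    then have "\<one> \<odot>\<^bsub>M\<^esub> act e r x \<in> N" using abs that by simp
    then show ?thesis
      unfolding generic_saturation_def using one that H0_stable[OF P.is_ideal] by blast
  qed
  then have "carrier (H0 R M \<eta>) \<subseteq> C_colon R act (generic_saturation \<eta> N) 1" by auto
  then show ?thesis using generic_nil_iso_iff[OF \<eta> N] by blast
qed

end

text \<open>After localization at \<open>\<eta>\<close> the hypothesis \<open>sub\<close> says that each operator of the second action is, up to
  a unit, one of the first.  Going through a product of operators, the units are cancelled one at a time
  with \<open>colon_cancel_Den\<close>.\<close>

lemma generic_nil_iso_transfer:
  assumes A: "cartier_action R M p act" and B: "cartier_action R M p act'"
    and \<eta>: "primeideal \<eta> R"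
    and N: "C_submodule R M act N" "C_submodule R M act' N'" and "N \<subseteq> N'"
    and sub: "\<And>e r x. e \<ge> 1 \<Longrightarrow> r \<in> carrier R \<Longrightarrow> x \<in> carrier M \<Longrightarrow>
      \<exists>c\<in>carrier R - \<eta>. \<exists>r'\<in>carrier R. c \<odot>\<^bsub>M\<^esub> act' e r x = act e r' x"
    and nil: "generic_nil_iso p R M act \<eta> N"
  shows "generic_nil_iso p R M act' \<eta> N'"
proof -
  interpret A: cartier_action R M p act by (rule A)
  interpret B: cartier_action R M p act' by (rule B)
  interpret P: primeideal \<eta> R by (rule \<eta>)
  let ?G = "carrier (H0 R M \<eta>)"
  interpret Q: cartier_pair_at_prime R "H0 R M \<eta>" p act' \<eta> "N' \<inter> ?G"
    by (rule B.H0_pair_at_prime[OF \<eta> N(2)])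
  have sat': "Q.saturation = B.generic_saturation \<eta> N'" by (rule B.saturation_H0[OF \<eta> N(2)])
  have colon: "x \<in> C_colon R act' (B.generic_saturation \<eta> N') a"
    if "x \<in> ?G" "x \<in> C_colon R act (A.generic_saturation \<eta> N) a" for x a
    using that
  proof (induction a arbitrary: x)
    case 0
    then show ?case
      using \<open>N \<subseteq> N'\<close> unfolding A.generic_saturation_def B.generic_saturation_def by auto
  next
    case (Suc a)
    have "act' e r x \<in> C_colon R act' (B.generic_saturation \<eta> N') a"
      if e: "e \<ge> 1" and r: "r \<in> carrier R" for e r
    proof -
      have x: "x \<in> carrier M" using Suc.prems(1) by (simp add: mem_H0_iff)
      obtain c r' where c: "c \<in> carrier R - \<eta>" "r' \<in> carrier R" "c \<odot>\<^bsub>M\<^esub> act' e r x = act e r' x"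
        using sub[OF e r x] by blast
      have "act e r' x \<in> C_colon R act' (B.generic_saturation \<eta> N') a"
        using Suc.prems e c(2) A.H0_stable[OF P.is_ideal] by (intro Suc.IH) simp_all
      then have "c \<odot>\<^bsub>H0 R M \<eta>\<^esub> act' e r x \<in> C_colon R act' Q.saturation a"
        using c(3) unfolding sat' by (simp add: H0_def)
      then show ?thesis
        using Q.colon_cancel_Den[of c "act' e r x" a] c(1) B.H0_stable[OF P.is_ideal r Suc.prems(1)]
        unfolding sat' Q.Den_def by simp
    qed
    then show ?case by simp
  qed
  show ?thesis
    using nil colon unfolding A.generic_nil_iso_iff[OF \<eta> N(1)] B.generic_nil_iso_iff[OF \<eta> N(2)]
    by blast
qed

lemma regular_not_in_assoc_prime:
  assumes "module R M" "regular_on R M f" "\<eta> \<in> assoc_primes R M"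
  shows "f \<notin> \<eta>"
proof
  assume f: "f \<in> \<eta>"
  obtain x where x: "primeideal \<eta> R" "x \<in> carrier M" "\<eta> = {r \<in> carrier R. r \<odot>\<^bsub>M\<^esub> x = \<zero>\<^bsub>M\<^esub>}"
    using assms(3) unfolding assoc_primes_def by blast
  then have "x = \<zero>\<^bsub>M\<^esub>" using f assms(2) unfolding regular_on_def by blast
  then have "\<eta> = carrier R" using x(3) module.smult_r_null[OF assms(1)] by auto
  then show False using primeideal.I_notcarr[OF x(1)] by simp
qed

section \<open>The images of powers of the Cartier map\<close>

locale cartier_with_element = module R M
  for R :: "'a ring" (structure) and M :: "('a, 'm) module" +
  fixes p :: nat and \<kappa> :: "'m \<Rightarrow> 'm" and f :: 'a
  assumes p_pos: "p > 0"
    and cartier: "cartier_module p R M \<kappa>"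
    and f_carrier [simp]: "f \<in> carrier R"
begin

lemma kappa_closed [simp]: "x \<in> carrier M \<Longrightarrow> \<kappa> x \<in> carrier M"
  and kappa_add: "x \<in> carrier M \<Longrightarrow> y \<in> carrier M \<Longrightarrow> \<kappa> (x \<oplus>\<^bsub>M\<^esub> y) = \<kappa> x \<oplus>\<^bsub>M\<^esub> \<kappa> y"
  and kappa_smult: "r \<in> carrier R \<Longrightarrow> x \<in> carrier M \<Longrightarrow> \<kappa> ((r [^] p) \<odot>\<^bsub>M\<^esub> x) = r \<odot>\<^bsub>M\<^esub> \<kappa> x"
  using cartier unfolding cartier_module_def linear_map_def frob_push_def by auto

lemma kappa_pow_closed [simp]: "x \<in> carrier M \<Longrightarrow> (\<kappa> ^^ e) x \<in> carrier M"
  by (induction e) simp_all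

lemma kappa_pow_add:
  "x \<in> carrier M \<Longrightarrow> y \<in> carrier M \<Longrightarrow> (\<kappa> ^^ e) (x \<oplus>\<^bsub>M\<^esub> y) = (\<kappa> ^^ e) x \<oplus>\<^bsub>M\<^esub> (\<kappa> ^^ e) y"
  by (induction e) (simp_all add: kappa_add)

lemma kappa_pow_smult:
  "r \<in> carrier R \<Longrightarrow> x \<in> carrier M \<Longrightarrow> r \<odot>\<^bsub>M\<^esub> (\<kappa> ^^ e) x = (\<kappa> ^^ e) ((r [^] (p ^ e)) \<odot>\<^bsub>M\<^esub> x)"
proof (induction e arbitrary: r)
  case (Suc e)
  have "r \<odot>\<^bsub>M\<^esub> (\<kappa> ^^ Suc e) x = \<kappa> ((r [^] p) \<odot>\<^bsub>M\<^esub> (\<kappa> ^^ e) x)"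
    using Suc.prems by (simp add: kappa_smult)
  also have "\<dots> = (\<kappa> ^^ Suc e) (((r [^] p) [^] (p ^ e)) \<odot>\<^bsub>M\<^esub> x)"
    using Suc.IH[of "r [^] p"] Suc.prems by simp
  finally show ?case using Suc.prems by (simp add: R.nat_pow_pow)
qed simp

lemma test_cartier_action: "cartier_action R M p (test_act p R M \<kappa> f t)"
proof (intro cartier_action.intro cartier_action_axioms.intro module_axioms p_pos)
  fix r x e assume r: "r \<in> carrier R" and x: "x \<in> carrier M"
  show "test_act p R M \<kappa> f t e r x \<in> carrier M"
    using r x by (simp add: test_act_def)
  show "test_act p R M \<kappa> f t e r (x \<oplus>\<^bsub>M\<^esub> y) = test_act p R M \<kappa> f t e r x \<oplus>\<^bsub>M\<^esub> test_act p R M \<kappa> f t e r y"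
    if "y \<in> carrier M" for y
    using r x that by (simp add: test_act_def smult_r_distr kappa_pow_add)
  fix a assume a: "a \<in> carrier R"
  show "test_act p R M \<kappa> f t e r (a \<odot>\<^bsub>M\<^esub> x) = test_act p R M \<kappa> f t e (r \<otimes> a) x"
    using r x a by (simp add: test_act_def smult_assoc1)
  show "a \<odot>\<^bsub>M\<^esub> test_act p R M \<kappa> f t e r x = test_act p R M \<kappa> f t e (r \<otimes> a [^] (p ^ e)) x"
    using r x a by (simp add: test_act_def kappa_pow_smult smult_assoc1[symmetric] R.m_ac)
qed

definition expo :: "rat \<Rightarrow> nat \<Rightarrow> nat" where "expo t e = nat \<lceil>t * of_nat p ^ e\<rceil>"

definition power_image :: "rat \<Rightarrow> nat \<Rightarrow> 'm set" where
  "power_image t e = (\<lambda>x. (\<kappa> ^^ e) ((f [^] expo t e) \<odot>\<^bsub>M\<^esub> x)) ` carrier M"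

lemma expo_add_le: "expo t (d + e) \<le> expo t d * p ^ e"
proof -
  have "t * of_nat p ^ d \<le> of_int \<lceil>t * of_nat p ^ d\<rceil>" by simp
  also have "\<dots> \<le> of_int (int (expo t d))" unfolding expo_def of_int_le_iff by simp
  finally have "t * of_nat p ^ d * of_nat p ^ e \<le> of_int (int (expo t d)) * (of_nat p ^ e :: rat)"
    by (rule mult_right_mono) simp
  then have "t * of_nat p ^ (d + e) \<le> of_int (int (expo t d * p ^ e))"
    by (simp add: power_add mult.assoc)
  then have "\<lceil>t * of_nat p ^ (d + e)\<rceil> \<le> int (expo t d * p ^ e)" by (simp only: ceiling_le_iff)
  then show ?thesis unfolding expo_def[of t "d + e"] by linarith
qed

lemma test_act_pos:
  "e \<ge> 1 \<Longrightarrow> test_act p R M \<kappa> f t e r x = (\<kappa> ^^ e) ((f [^] expo t e) \<odot>\<^bsub>M\<^esub> (r \<odot>\<^bsub>M\<^esub> x))"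
  by (simp add: test_act_def expo_def)

lemma test_act_trivial_exponent:
  "e \<ge> 1 \<Longrightarrow> r \<in> carrier R \<Longrightarrow> x \<in> carrier M \<Longrightarrow> test_act p R M \<kappa> f 0 e r x = (\<kappa> ^^ e) (r \<odot>\<^bsub>M\<^esub> x)"
  by (simp add: test_act_def)

text \<open>Surplus powers of \<open>f\<close> are absorbed by \<open>M\<close>.\<close>

lemma power_imageI:
  assumes "n \<ge> expo t e" "x \<in> carrier M"
  shows "(\<kappa> ^^ e) ((f [^] n) \<odot>\<^bsub>M\<^esub> x) \<in> power_image t e"
proof -
  have "f [^] n = f [^] expo t e \<otimes> f [^] (n - expo t e)"
    using assms(1) by (simp add: R.nat_pow_mult)
  then have "(\<kappa> ^^ e) ((f [^] n) \<odot>\<^bsub>M\<^esub> x) = (\<kappa> ^^ e) ((f [^] expo t e) \<odot>\<^bsub>M\<^esub> ((f [^] (n - expo t e)) \<odot>\<^bsub>M\<^esub> x))"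
    using assms(2) by (simp add: smult_assoc1)
  then show ?thesis unfolding power_image_def by (rule image_eqI) (simp add: assms(2))
qed

lemma power_image_submodule: "submodule (power_image t e) R M"
proof (rule submoduleI)
  show "power_image t e \<subseteq> carrier M" by (auto simp: power_image_def)
  have smult: "r \<odot>\<^bsub>M\<^esub> y \<in> power_image t e" if y: "y \<in> power_image t e" and r: "r \<in> carrier R" for r y
  proof -
    obtain x where x: "x \<in> carrier M" "y = (\<kappa> ^^ e) ((f [^] expo t e) \<odot>\<^bsub>M\<^esub> x)"
      using y unfolding power_image_def by blast
    then have "r \<odot>\<^bsub>M\<^esub> y = (\<kappa> ^^ e) ((f [^] expo t e) \<odot>\<^bsub>M\<^esub> ((r [^] (p ^ e)) \<odot>\<^bsub>M\<^esub> x))"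
      using r by (simp add: kappa_pow_smult smult_assoc1[symmetric] R.m_comm)
    then show ?thesis using power_imageI[of t e "expo t e"] x r by simp
  qed
  then show "r \<odot>\<^bsub>M\<^esub> y \<in> power_image t e" if "r \<in> carrier R" "y \<in> power_image t e" for r y
    using that by blast
  have "\<zero>\<^bsub>M\<^esub> = \<zero> \<odot>\<^bsub>M\<^esub> (\<kappa> ^^ e) ((f [^] expo t e) \<odot>\<^bsub>M\<^esub> \<zero>\<^bsub>M\<^esub>)" by simp
  then show "\<zero>\<^bsub>M\<^esub> \<in> power_image t e"
    using smult[OF power_imageI[OF order_refl M.zero_closed] R.zero_closed] by simp
  fix y assume y: "y \<in> power_image t e"
  then have yM: "y \<in> carrier M" by (auto simp: power_image_def)
  show "\<ominus>\<^bsub>M\<^esub> y \<in> power_image t e"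
    using smult[OF y, of "\<ominus> \<one>"] yM by (simp add: smult_l_minus)
  fix z assume z: "z \<in> power_image t e"
  obtain a b where "a \<in> carrier M" "y = (\<kappa> ^^ e) ((f [^] expo t e) \<odot>\<^bsub>M\<^esub> a)"
    "b \<in> carrier M" "z = (\<kappa> ^^ e) ((f [^] expo t e) \<odot>\<^bsub>M\<^esub> b)"
    using y z unfolding power_image_def by blast
  then show "y \<oplus>\<^bsub>M\<^esub> z \<in> power_image t e"
    using power_imageI[of t e "expo t e" "a \<oplus>\<^bsub>M\<^esub> b"]
    by (simp add: smult_r_distr kappa_pow_add)
qed

lemma test_act_in_power_image:
  "e \<ge> 1 \<Longrightarrow> r \<in> carrier R \<Longrightarrow> x \<in> carrier M \<Longrightarrow> test_act p R M \<kappa> f t e r x \<in> power_image t e"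
  by (simp add: test_act_pos power_imageI)

lemma test_candidate_if_absorbs:
  assumes "submodule N R M"
    and "\<And>e r x. e \<ge> 1 \<Longrightarrow> r \<in> carrier R \<Longrightarrow> x \<in> carrier M \<Longrightarrow> test_act p R M \<kappa> f t e r x \<in> N"
  shows "test_candidate p R M \<kappa> f t N"
proof -
  interpret A: cartier_action R M p "test_act p R M \<kappa> f t" by (rule test_cartier_action)
  have sub: "C_submodule R M (test_act p R M \<kappa> f t) N"
    by (rule A.C_submodule_if_absorbs[OF assms(1) _ assms(2)]) (simp_all add: test_act_def)
  then show ?thesis
    using A.generic_nil_iso_if_absorbs[OF _ sub assms(2)]
    unfolding test_candidate_def assoc_primes_def by blast
qed

text \<open>\<open>M / \<kappa> M\<close> is killed by \<open>\<kappa>\<close>, so \<open>\<kappa> M\<close> is a candidate for \<open>\<tau>(M, f\<^sup>0)\<close>, and the smallest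
  candidate is \<open>M\<close>.\<close>

lemma kappa_surj_if_F_regular:
  assumes "F_regular p R M \<kappa>"
  shows "\<kappa> ` carrier M = carrier M"
proof -
  have ex0: "expo 0 1 = 0" by (simp add: expo_def)
  have im: "power_image 0 1 = \<kappa> ` carrier M"
    unfolding power_image_def ex0 by (rule image_cong) simp_all
  have "test_act p R M \<kappa> f 0 e r x \<in> \<kappa> ` carrier M"
    if e: "e \<ge> 1" and rx: "r \<in> carrier R" "x \<in> carrier M" for e r x
  proof -
    obtain d where d: "e = Suc d" using e by (cases e) simp_all
    have "test_act p R M \<kappa> f 0 e r x = \<kappa> ((\<kappa> ^^ d) (r \<odot>\<^bsub>M\<^esub> x))"
      using test_act_trivial_exponent[OF e rx] by (simp add: d)
    then show ?thesis using rx by simp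
  qed
  then have "test_candidate p R M \<kappa> f 0 (\<kappa> ` carrier M)"
    using power_image_submodule[of 0 1] unfolding im by (intro test_candidate_if_absorbs)
  then have "carrier M \<subseteq> \<kappa> ` carrier M"
    using assms unfolding F_regular_iff[of p R M \<kappa> f] is_test_module_def by blast
  then show ?thesis by auto
qed

text \<open>Replacing \<open>M\<close> by \<open>\<kappa> M\<close> in \<open>\<kappa>\<^sup>d f\<^bsup>m\<^esup> M\<close> gives \<open>\<kappa>\<^bsup>d+1\<^esup> f\<^bsup>p m\<^esup> M\<close>, where \<open>p m\<close> is at least the exponent
  in degree \<open>d + 1\<close>.\<close>

lemma power_image_mono:
  assumes "\<kappa> ` carrier M = carrier M" and "d \<le> e"
  shows "power_image t d \<subseteq> power_image t e"
proof -
  have "power_image t d \<subseteq> power_image t (Suc d)" for d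
  proof
    fix z assume "z \<in> power_image t d"
    then obtain x where x: "x \<in> carrier M" "z = (\<kappa> ^^ d) ((f [^] expo t d) \<odot>\<^bsub>M\<^esub> x)"
      unfolding power_image_def by blast
    obtain y where y: "y \<in> carrier M" "x = \<kappa> y" using x(1) assms(1) by blast
    have "z = (\<kappa> ^^ d) (\<kappa> (((f [^] expo t d) [^] p) \<odot>\<^bsub>M\<^esub> y))"
      using x y by (simp add: kappa_smult)
    also have "\<dots> = (\<kappa> ^^ Suc d) ((f [^] (expo t d * p)) \<odot>\<^bsub>M\<^esub> y)"
      by (simp add: funpow_swap1 R.nat_pow_pow)
    also have "\<dots> \<in> power_image t (Suc d)"
      using expo_add_le[of t d 1] y by (intro power_imageI) simp_all
    finally show "z \<in> power_image t (Suc d)" .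
  qed
  then show ?thesis using assms(2) by (rule lift_Suc_mono_le)
qed

text \<open>The auxiliary \<open>P = (N : C\<^sub>+)\<close> is a candidate for \<open>\<tau>(M, f\<^sup>0)\<close>: for \<open>x \<in> P\<close> the operators of \<open>C\<^sub>+\<close>
  send \<open>\<kappa>\<^sup>e x\<close> into \<open>C\<^sub>+ x\<close>, and \<open>N \<subseteq> P\<close> is generically nil-isomorphic to \<open>M\<close>.  So \<open>P = M\<close> by
  \<open>F\<close>-regularity.\<close>

lemma test_candidate_contains_power_image:
  assumes reg: "regular_on R M f" and F: "F_regular p R M \<kappa>"
    and cand: "test_candidate p R M \<kappa> f t N" and E: "E \<ge> 1"
  shows "power_image t E \<subseteq> N"
proof -
  let ?act = "test_act p R M \<kappa> f t" and ?base = "test_act p R M \<kappa> f 0"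
  interpret A: cartier_action R M p ?act by (rule test_cartier_action)
  interpret A0: cartier_action R M p ?base by (rule test_cartier_action)
  have N: "C_submodule R M ?act N" using cand unfolding test_candidate_def by blast
  then have N': "submodule N R M" "\<And>e r x. r \<in> carrier R \<Longrightarrow> x \<in> N \<Longrightarrow> ?act e r x \<in> N"
    unfolding C_submodule_def by auto
  note NE = submoduleE[OF N'(1)]
  define P where "P = {x \<in> carrier M. \<forall>e\<ge>1. \<forall>r\<in>carrier R. ?act e r x \<in> N}"
  have P: "submodule P R M"
    by (rule submoduleI)
      (use NE submodule_zero_mem[OF N'(1)]
        in \<open>auto simp: P_def A.act_zero A.act_minus A.act_add A.act_smult\<close>)
  have stable: "?base e r x \<in> P" if r: "r \<in> carrier R" and x: "x \<in> P" for e r x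
  proof (cases "e = 0")
    case True
    then show ?thesis using submoduleE(4)[OF P r x] by (simp add: test_act_def)
  next
    case False
    have xM: "x \<in> carrier M" using x by (simp add: P_def)
    have "?act d s (?base e r x) \<in> N" if d: "d \<ge> 1" and s: "s \<in> carrier R" for d s
    proof -
      \<comment> \<open>The power of \<open>f\<close> left over when \<open>f\<close> is moved past \<open>\<kappa>\<^sup>e\<close>.\<close>
      define b where "b = expo t d * p ^ e - expo t (d + e)"
      have pw: "f [^] (expo t d * p ^ e) = f [^] expo t (d + e) \<otimes> f [^] b"
        unfolding b_def using expo_add_le[of t d e] by (simp add: R.nat_pow_mult)
      have e: "e \<ge> 1" using False by simp
      have de: "d + e \<ge> 1" using d by simp
      have "?act d s (?base e r x) = (\<kappa> ^^ d) ((f [^] expo t d \<otimes> s) \<odot>\<^bsub>M\<^esub> (\<kappa> ^^ e) (r \<odot>\<^bsub>M\<^esub> x))"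
        unfolding test_act_pos[OF d] test_act_trivial_exponent[OF e r xM]
        using s r xM by (simp add: smult_assoc1)
      also have "\<dots> = (\<kappa> ^^ (d + e)) (((f [^] expo t d \<otimes> s) [^] (p ^ e)) \<odot>\<^bsub>M\<^esub> (r \<odot>\<^bsub>M\<^esub> x))"
        using s r xM by (simp add: kappa_pow_smult funpow_add)
      also have "(f [^] expo t d \<otimes> s) [^] (p ^ e) = f [^] expo t (d + e) \<otimes> (f [^] b \<otimes> s [^] (p ^ e))"
        using s by (simp add: R.nat_pow_distrib R.nat_pow_pow pw R.m_assoc)
      also have "(\<kappa> ^^ (d + e)) ((f [^] expo t (d + e) \<otimes> (f [^] b \<otimes> s [^] (p ^ e))) \<odot>\<^bsub>M\<^esub> (r \<odot>\<^bsub>M\<^esub> x)) =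
          ?act (d + e) (f [^] b \<otimes> s [^] (p ^ e) \<otimes> r) x"
        unfolding test_act_pos[OF de] using s r xM by (simp add: smult_assoc1)
      also have "\<dots> \<in> N" using x s r de unfolding P_def by simp
      finally show ?thesis .
    qed
    moreover have "?base e r x \<in> carrier M" using r xM by simp
    ultimately show ?thesis unfolding P_def by blast
  qed
  have "test_candidate p R M \<kappa> f 0 P"
    unfolding test_candidate_def
  proof (intro conjI ballI)
    show C: "C_submodule R M ?base P" using P stable unfolding C_submodule_def by blast
    fix \<eta> assume \<eta>: "\<eta> \<in> assoc_primes R M"
    then have prime: "primeideal \<eta> R" unfolding assoc_primes_def by blast
    interpret primeideal \<eta> R by (rule prime)
    interpret D: module_at_prime R M \<eta> by (intro module_at_prime.intro module_axioms prime)
    have f: "f \<in> D.Den"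
      using regular_not_in_assoc_prime[OF module_axioms reg \<eta>] by (simp add: D.Den_def)
    show "generic_nil_iso p R M ?base \<eta> P"
    proof (rule generic_nil_iso_transfer[OF A.cartier_action_axioms A0.cartier_action_axioms prime N C])
      show "N \<subseteq> P" unfolding P_def using N'(2) NE(1) by blast
      show "generic_nil_iso p R M ?act \<eta> N" using cand \<eta> unfolding test_candidate_def by blast
      fix e r x assume e: "e \<ge> (1::nat)" and r: "r \<in> carrier R" and x: "x \<in> carrier M"
      \<comment> \<open>\<open>c\<close> is the power of \<open>f\<close> which occurs in degree \<open>e\<close>; it is a unit at \<open>\<eta>\<close>.\<close>
      define b where "b = expo t e * p ^ e - expo t e"
      have "f [^] (expo t e * p ^ e) = f [^] expo t e \<otimes> f [^] b"
        unfolding b_def using p_pos by (simp add: R.nat_pow_mult)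
      then have "(f [^] expo t e) \<odot>\<^bsub>M\<^esub> ?base e r x = ?act e (f [^] b \<otimes> r) x"
        unfolding test_act_trivial_exponent[OF e r x] unfolding test_act_pos[OF e] using r x
        by (simp add: kappa_pow_smult R.nat_pow_pow smult_assoc1)
      moreover have "f [^] expo t e \<in> carrier R - \<eta>" using D.pow_in_Den[OF f] by (simp add: D.Den_def)
      moreover have "f [^] b \<otimes> r \<in> carrier R" using r by simp
      ultimately show "\<exists>c\<in>carrier R - \<eta>. \<exists>r'\<in>carrier R. c \<odot>\<^bsub>M\<^esub> ?base e r x = ?act e r' x" by blast
    qed
  qed
  then have "carrier M \<subseteq> P"
    using F unfolding F_regular_iff[of p R M \<kappa> f] is_test_module_def by blast
  then have "?act E \<one> x \<in> N" if "x \<in> carrier M" for x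
    using that E unfolding P_def by blast
  then show ?thesis
    unfolding power_image_def test_act_pos[OF E] by auto
qed

end

theorem theorem2p6:
  fixes p :: nat and k :: "'k ring" and A :: "'b ring" and S :: "'b set" and R :: "'a ring"
    and \<iota> :: "'k \<Rightarrow> 'b" and \<psi> :: "'b \<Rightarrow> 'a"
    and M :: "('a, 'm) module" and \<kappa> :: "'m \<Rightarrow> 'm" and f :: 'a and t :: rat
  assumes "Factorial_Ring.prime p"
    and "field k" and "has_char k p" and "F_finite p k"
    and "fin_gen_algebra k A \<iota>" and "is_localization A S R \<psi>"
    and "noetherian_ring R"
    and "cartier_module p R M \<kappa>"
    and "regular_on R M f"
    and "t \<ge> 0"
    and "F_regular p R M \<kappa>"
  shows "\<forall>\<^sub>F e in sequentially.
    is_test_module p R M \<kappa> f t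
      ((\<lambda>x. (\<kappa> ^^ e) ((f [^]\<^bsub>R\<^esub> nat \<lceil>t * of_nat p ^ e\<rceil>) \<odot>\<^bsub>M\<^esub> x)) ` carrier M)"
proof -
  have fg: "fin_gen_module R M" using assms(8) by (simp add: cartier_module_def)
  interpret cartier_with_element R M p \<kappa> f
    using fg assms(1,8,9)
    by (intro cartier_with_element.intro cartier_with_element_axioms.intro)
      (auto simp: fin_gen_module_def regular_on_def prime_gt_0_nat)
  note mono = power_image_mono[OF kappa_surj_if_F_regular[OF assms(11)]]
  obtain n where n: "\<And>m. m \<ge> n \<Longrightarrow> power_image t m = power_image t n"
    using submodule_chain_stabilizes[OF assms(7) fg, of "power_image t"] power_image_submodule mono
    by blast
  \<comment> \<open>Degree zero has to be excluded: there \<open>C\<^sub>0 = R\<close> acts without any power of \<open>f\<close>.\<close>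
  have "is_test_module p R M \<kappa> f t (power_image t e)" if e: "e \<ge> max n 1" for e
  proof -
    have "power_image t d \<subseteq> power_image t e" for d
      using mono[of d "max d n" t] n[of "max d n"] n[of e] e by simp
    then have "test_candidate p R M \<kappa> f t (power_image t e)"
      using test_act_in_power_image
      by (intro test_candidate_if_absorbs power_image_submodule) blast
    then show ?thesis
      unfolding is_test_module_def
      using test_candidate_contains_power_image[OF assms(9,11)] e by simp
  qed
  then show ?thesis
    unfolding eventually_sequentially power_image_def expo_def by blast
qed

end
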